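(* Let $b$ be a prime, $m\in\mathbb{N}$, $N=b^m$, $s\in\mathbb{N}$, $\alpha>1$, and let $(\gamma_{\mathfrak{u}})$ be positive weights, indexed by finite sets $\mathfrak{u}\subset\mathbb{N}$, with $\gamma_\emptyset=1$. Let $\boldsymbol{z}^0\in\{0,1,\ldots,N-1\}^s$ be an arbitrary initial vector. Then the successive coordinate search (SCS) algorithm (defined in the context) started from $\boldsymbol{z}^0$ constructs $\boldsymbol{z}=(z_1,\ldots,z_s)$ such that, for every $\lambda\in(\frac1\alpha,1]$, the squared worst-case error in the weighted Korobov space $\mathcal{H}(K_{s,\alpha,\boldsymbol{\gamma}})$ satisfies $$e_{N,s}^2((z_1,\ldots,z_s))\le\left(\sum_{\emptyset\ne\mathfrak{u}\subseteq[s]}|\mathfrak{u}|\,\gamma_{\mathfrak{u}}^{\lambda}\,\frac{2\,(2\zeta(\alpha\lambda))^{|\mathfrak{u}|}}{b^m}\right)^{1/\lambda}.$$ In particular, $e_{N,s}(\boldsymbol{z})\in\mathcal{O}(N^{-\alpha/2+\delta})$ for $\delta\in(0,\frac{\alpha-1}{2}]$ arbitrarily close to zero, where the implied constant is independent of $s$ if $$\sup_{s\in\mathbb{N}}\left[2\sum_{\emptyset\ne\mathfrak{u}\subseteq[s]}|\mathfrak{u}|\,\gamma_{\mathfrak{u}}^{\frac{1}{\alpha-2\delta}}\left(2\zeta\left(\tfrac{\alpha}{\alpha-2\delta}\right)\right)^{|\mathfrak{u}|}\right]<\infty.$$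
   Context: Notation: $[s]=\{1,\ldots,s\}$, $\mathbb{Z}_*=\mathbb{Z}\setminus\{0\}$; for a vector $\boldsymbol{x}$ and $\mathfrak{u}\subseteq[s]$, $\boldsymbol{x}_{\mathfrak{u}}=(x_j)_{j\in\mathfrak{u}}$; $\{\cdot\}$ is the fractional part, applied componentwise; $\zeta$ is the Riemann zeta function. Weighted Korobov space: $\mathcal{H}(K_{s,\alpha,\boldsymbol{\gamma}})$ is the reproducing kernel Hilbert space of functions on $[0,1]^s$ with kernel $$K_{s,\alpha,\boldsymbol{\gamma}}(\boldsymbol{x},\boldsymbol{y})=1+\sum_{\emptyset\ne\mathfrak{u}\subseteq[s]}\gamma_{\mathfrak{u}}\sum_{\boldsymbol{h}_{\mathfrak{u}}\in\mathbb{Z}_*^{|\mathfrak{u}|}}\frac{\exp(2\pi \mathrm{i}\,\boldsymbol{h}_{\mathfrak{u}}\cdot(\boldsymbol{x}_{\mathfrak{u}}-\boldsymbol{y}_{\mathfrak{u}}))}{\prod_{j\in\mathfrak{u}}|h_j|^\alpha}.$$ Worst-case error: for $\boldsymbol{\xi}\in\mathbb{Z}^s$, $e_{N,s}(\boldsymbol{\xi})$ is the supremum of $\left|\int_{[0,1]^s}f(\boldsymbol{x})\,\mathrm{d}\boldsymbol{x}-\frac1N\sum_{n=0}^{N-1}f(\{n\boldsymbol{\xi}/N\})\right|$ over all $f$ in the unit ball of $\mathcal{H}(K_{s,\alpha,\boldsymbol{\gamma}})$. It is known that $$e_{N,s}^2(\boldsymbol{\xi})=\sum_{\emptyset\ne\mathfrak{u}\subseteq[s]}\gamma_{\mathfrak{u}}\sum_{\boldsymbol{h}_{\mathfrak{u}}\in\mathcal{D}_{\mathfrak{u}}(\boldsymbol{\xi}_{\mathfrak{u}})}\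 \prod_{j\in\mathfrak{u}}|h_j|^{-\alpha},\qquad \mathcal{D}_{\mathfrak{u}}(\boldsymbol{\xi}_{\mathfrak{u}})=\{\boldsymbol{h}_{\mathfrak{u}}\in\mathbb{Z}_*^{|\mathfrak{u}|}:\boldsymbol{h}_{\mathfrak{u}}\cdot\boldsymbol{\xi}_{\mathfrak{u}}\equiv0\ (\mathrm{mod}\ N)\}.$$ SCS algorithm: let $\mathcal{Z}_N=\{z\in\{1,2,\ldots,N-1\}:\gcd(z,N)=1\}$. Given $\boldsymbol{z}^0=(z_1^0,\ldots,z_s^0)$, for $d=1,2,\ldots,s$ successively, with $z_1,\ldots,z_{d-1}$ already selected, choose $z_d\in\mathcal{Z}_N$ such that $e_{N,s}^2((z_1,\ldots,z_{d-1},z_d,z_{d+1}^0,\ldots,z_s^0))$ is minimized as a function of $z_d$ over $\mathcal{Z}_N$. The output is $\boldsymbol{z}=(z_1,\ldots,z_s)$. The $\mathcal{O}$-statement refers to $N=b^m$ with $m$ varying. *)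

theory Defs
  imports "HOL-Analysis.Analysis" "HOL-Library.Landau_Symbols"
begin

text \<open>
  Vectors indexed by \<open>{1..s}\<close> are functions on \<open>nat\<close> of which only the values on \<open>{1..s}\<close> matter;
  points of the unit cube are moreover extensional.
\<close>

definition unit_cube :: "nat \<Rightarrow> (nat \<Rightarrow> real) set" where
  "unit_cube s = {1..s} \<rightarrow>\<^sub>E {0..1}"

definition hnorm :: "('f \<Rightarrow> 'f \<Rightarrow> complex) \<Rightarrow> 'f \<Rightarrow> real" where
  "hnorm ip f = sqrt (Re (ip f f))"

text \<open>
  A complex-valued function on \<open>X\<close> is represented by a total function that vanishes
  outside \<open>X\<close>, so that pointwise operations and equality of functions on \<open>X\<close> are those of the type.
\<close>

definition kernel_section :: "'a set \<Rightarrow> ('a \<Rightarrow> 'a \<Rightarrow> complex) \<Rightarrow> 'a \<Rightarrow> 'a \<Rightarrow> complex" where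
  "kernel_section X K y = (\<lambda>x. if x \<in> X then K x y else 0)"

text \<open>
  \<open>V\<close> with the inner product \<open>ip\<close> (linear in the first argument) is the Hilbert space of functions
  on \<open>X\<close> with reproducing kernel \<open>K\<close>; by the theorem of Moore and Aronszajn such a space exists for
  every positive semidefinite kernel, and \<open>V\<close> and the values of \<open>ip\<close> on \<open>V\<close> are determined by \<open>K\<close>.
\<close>

locale reproducing_kernel_hilbert_space =
  fixes X :: "'a set"
    and K :: "'a \<Rightarrow> 'a \<Rightarrow> complex"
    and V :: "('a \<Rightarrow> complex) set"
    and ip :: "('a \<Rightarrow> complex) \<Rightarrow> ('a \<Rightarrow> complex) \<Rightarrow> complex"
  assumes supported: "\<And>f x. f \<in> V \<Longrightarrow> x \<notin> X \<Longrightarrow> f x = 0"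
    and zero_mem: "(\<lambda>x. 0) \<in> V"
    and add_mem: "\<And>f g. f \<in> V \<Longrightarrow> g \<in> V \<Longrightarrow> (\<lambda>x. f x + g x) \<in> V"
    and scale_mem: "\<And>c f. f \<in> V \<Longrightarrow> (\<lambda>x. c * f x) \<in> V"
    and ip_add_left:
      "\<And>f g h. f \<in> V \<Longrightarrow> g \<in> V \<Longrightarrow> h \<in> V \<Longrightarrow> ip (\<lambda>x. f x + g x) h = ip f h + ip g h"
    and ip_scale_left: "\<And>c f g. f \<in> V \<Longrightarrow> g \<in> V \<Longrightarrow> ip (\<lambda>x. c * f x) g = c * ip f g"
    and ip_cnj: "\<And>f g. f \<in> V \<Longrightarrow> g \<in> V \<Longrightarrow> ip g f = cnj (ip f g)"
    and ip_nonneg: "\<And>f. f \<in> V \<Longrightarrow> 0 \<le> Re (ip f f)"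
    and ip_definite: "\<And>f. f \<in> V \<Longrightarrow> ip f f = 0 \<Longrightarrow> f = (\<lambda>x. 0)"
    and complete:
      "\<And>F :: nat \<Rightarrow> 'a \<Rightarrow> complex. (\<And>n. F n \<in> V) \<Longrightarrow>
        (\<And>\<epsilon>. \<epsilon> > 0 \<Longrightarrow> \<exists>M. \<forall>m\<ge>M. \<forall>n\<ge>M. hnorm ip (\<lambda>x. F m x - F n x) < \<epsilon>) \<Longrightarrow>
        \<exists>f\<in>V. (\<lambda>n. hnorm ip (\<lambda>x. F n x - f x)) \<longlonglongrightarrow> 0"
    and kernel_mem: "\<And>y. y \<in> X \<Longrightarrow> kernel_section X K y \<in> V"
    and reproducing: "\<And>f y. f \<in> V \<Longrightarrow> y \<in> X \<Longrightarrow> f y = ip f (kernel_section X K y)"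

definition korobov_kernel ::
  "real \<Rightarrow> (nat set \<Rightarrow> real) \<Rightarrow> nat \<Rightarrow> (nat \<Rightarrow> real) \<Rightarrow> (nat \<Rightarrow> real) \<Rightarrow> complex" where
  "korobov_kernel \<alpha> \<gamma> s x y =
    1 + (\<Sum>u\<in>Pow {1..s} - {{}}. complex_of_real (\<gamma> u) *
      (\<Sum>\<^sub>\<infinity>h\<in>u \<rightarrow>\<^sub>E (UNIV - {0 :: int}).
        exp (2 * complex_of_real pi * \<i> * complex_of_real (\<Sum>j\<in>u. real_of_int (h j) * (x j - y j)))
        / complex_of_real (\<Prod>j\<in>u. real_of_int \<bar>h j\<bar> powr \<alpha>)))"

definition cube_integral :: "nat \<Rightarrow> ((nat \<Rightarrow> real) \<Rightarrow> complex) \<Rightarrow> complex" where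
  "cube_integral s f = (LINT x|Pi\<^sub>M {1..s} (\<lambda>_. restrict_space lborel {0..1}). f x)"

definition lattice_point :: "nat \<Rightarrow> nat \<Rightarrow> (nat \<Rightarrow> int) \<Rightarrow> nat \<Rightarrow> nat \<Rightarrow> real" where
  "lattice_point N s \<xi> n = (\<lambda>j\<in>{1..s}. frac (real n * real_of_int (\<xi> j) / real N))"

definition worst_case_error ::
  "((nat \<Rightarrow> real) \<Rightarrow> complex) set \<Rightarrow>
   (((nat \<Rightarrow> real) \<Rightarrow> complex) \<Rightarrow> ((nat \<Rightarrow> real) \<Rightarrow> complex) \<Rightarrow> complex) \<Rightarrow>
   nat \<Rightarrow> nat \<Rightarrow> (nat \<Rightarrow> int) \<Rightarrow> real" where
  "worst_case_error V ip N s \<xi> =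
    (SUP f\<in>{f \<in> V. hnorm ip f \<le> 1}.
      cmod (cube_integral s f - (1 / of_nat N) * (\<Sum>n<N. f (lattice_point N s \<xi> n))))"

definition unit_residues :: "nat \<Rightarrow> int set" where
  "unit_residues N = {z \<in> {1..int N - 1}. coprime z (int N)}"

text \<open>
  Ties in the minimisation may be broken arbitrarily, so the successive coordinate search is the
  relation between a starting vector \<open>z0\<close> and all its possible outputs \<open>z\<close>.
\<close>

definition scs_output ::
  "((nat \<Rightarrow> real) \<Rightarrow> complex) set \<Rightarrow>
   (((nat \<Rightarrow> real) \<Rightarrow> complex) \<Rightarrow> ((nat \<Rightarrow> real) \<Rightarrow> complex) \<Rightarrow> complex) \<Rightarrow>
   nat \<Rightarrow> nat \<Rightarrow> (nat \<Rightarrow> int) \<Rightarrow> (nat \<Rightarrow> int) \<Rightarrow> bool" where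
  "scs_output V ip N s z0 z \<longleftrightarrow>
    (\<forall>d\<in>{1..s}. is_arg_min
      (\<lambda>y. (worst_case_error V ip N s
              (\<lambda>j. if j < d then z j else if j = d then y else z0 j))\<^sup>2)
      (\<lambda>y. y \<in> unit_residues N) (z d))"

text \<open>The Riemann zeta function on real arguments; meaningful only for \<open>x > 1\<close>.\<close>

definition zeta :: "real \<Rightarrow> real" where
  "zeta x = (\<Sum>n. 1 / real (Suc n) powr x)"

end

theory Submission imports Defs "HOL-Number_Theory.Totient"
begin

text \<open>
  Let \<open>1\<close> be the constant function and \<open>q\<close> the mean of the kernel sections at the lattice points.
  Means of kernel sections over finer and finer grids are Cauchy and converge to \<open>1\<close>, because only
  frequencies divisible by the grid size survive; hence \<open>1\<close> lies in the space, and comparing with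
  Riemann sums shows that it represents the integral. So the worst-case error is the norm of
  \<open>1 - q\<close>, and its square is \<open>\<Sum>u. \<gamma> u * dual_sum \<alpha> N u \<xi>\<close>.

  For the bound, let \<open>T d\<close> be the part of the squared error over the sets \<open>u\<close> containing \<open>d\<close>, taken
  right after step \<open>d\<close> of the search. The sets with maximum \<open>d\<close> only involve components which are
  final by then, so the squared error of the output is at most \<open>\<Sum>d. T d\<close>; summing over all
  \<open>d \<in> u\<close> produces the factor \<open>card u\<close>. The other sets do not depend on the choice made in step \<open>d\<close>,
  so \<open>T d powr \<theta>\<close> is minimal and hence at most its mean over the choices. By subadditivity of
  \<open>x powr \<theta>\<close> this mean is controlled by \<open>dual_sum (\<alpha> * \<theta>)\<close>, which is averaged by
  counting unit solutions of a linear congruence.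
\<close>

subsection \<open>Sums over nonzero integer frequencies\<close>

text \<open>The reciprocal of the denominators in the kernel. The exponent is a parameter because
  \<open>\<alpha> * \<theta>\<close> will occur besides \<open>\<alpha>\<close>.\<close>

definition freq_weight :: "real \<Rightarrow> nat set \<Rightarrow> (nat \<Rightarrow> int) \<Rightarrow> real" where
  "freq_weight \<beta> u h = (\<Prod>j\<in>u. real_of_int \<bar>h j\<bar> powr - \<beta>)"

text \<open>For \<open>\<beta> = \<alpha>\<close> this is the inner sum in the formula for the
  squared worst-case error. The extensional function space counts every frequency vector on
  \<open>u\<close> exactly once.\<close>

definition dual_sum :: "real \<Rightarrow> nat \<Rightarrow> nat set \<Rightarrow> (nat \<Rightarrow> int) \<Rightarrow> real" where
  "dual_sum \<beta> N u \<xi> =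
    (\<Sum>\<^sub>\<infinity>h\<in>{h \<in> u \<rightarrow>\<^sub>E (UNIV - {0}). int N dvd (\<Sum>j\<in>u. h j * \<xi> j)}. freq_weight \<beta> u h)"

lemma freq_weight_nonneg: "0 \<le> freq_weight \<beta> u h"
  unfolding freq_weight_def by (intro prod_nonneg) auto

lemma has_sum_finite_sum:
  fixes f :: "'i \<Rightarrow> 'a \<Rightarrow> 'b :: {comm_monoid_add, topological_comm_monoid_add}"
  assumes "finite I" "\<And>i. i \<in> I \<Longrightarrow> (f i has_sum S i) A"
  shows "((\<lambda>x. \<Sum>i\<in>I. f i x) has_sum (\<Sum>i\<in>I. S i)) A"
  using assms by (induction I rule: finite_induct) (auto intro!: has_sum_add)

lemma infsum_finite_sum:
  fixes f :: "'i \<Rightarrow> 'a \<Rightarrow> 'b :: {comm_monoid_add, topological_comm_monoid_add, t2_space}"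
  assumes "finite I" "\<And>i. i \<in> I \<Longrightarrow> f i summable_on A"
  shows "(\<Sum>\<^sub>\<infinity>x\<in>A. \<Sum>i\<in>I. f i x) = (\<Sum>i\<in>I. \<Sum>\<^sub>\<infinity>x\<in>A. f i x)"
  using assms by (intro infsumI has_sum_finite_sum) auto

lemma zeta_has_sum:
  assumes "\<beta> > 1"
  shows "((\<lambda>n. real n powr - \<beta>) has_sum zeta \<beta>) {1..}"
proof -
  have "summable (\<lambda>n. real n powr - \<beta>)"
    using assms by (simp add: summable_real_powr_iff)
  hence "summable (\<lambda>n. real (Suc n) powr - \<beta>)"
    by (subst summable_Suc_iff)
  hence "(\<lambda>n. real (Suc n) powr - \<beta>) sums zeta \<beta>"
    unfolding zeta_def by (simp add: powr_minus divide_inverse summable_sums)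
  hence "((\<lambda>n. real (Suc n) powr - \<beta>) has_sum zeta \<beta>) UNIV"
    by (intro sums_nonneg_imp_has_sum) auto
  moreover have "bij_betw Suc UNIV {1..}"
    by (rule bij_betwI[of _ _ _ "\<lambda>n. n - 1"]) auto
  ultimately show ?thesis
    by (subst has_sum_reindex_bij_betw[symmetric, of Suc UNIV]) auto
qed

lemma nonzero_int_has_sum:
  assumes "\<beta> > 1"
  shows "((\<lambda>h. real_of_int \<bar>h\<bar> powr - \<beta>) has_sum 2 * zeta \<beta>) (UNIV - {0})"
proof -
  have bij: "bij_betw int {1..} {1..}"
    by (rule bij_betwI[of _ _ _ nat]) auto
  have pos: "((\<lambda>h. real_of_int \<bar>h\<bar> powr - \<beta>) has_sum zeta \<beta>) {1..}"
    using zeta_has_sum[OF assms]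
    using has_sum_reindex_bij_betw[OF bij, of "\<lambda>h. real_of_int \<bar>h\<bar> powr - \<beta>"] by simp
  have neg: "((\<lambda>h. real_of_int \<bar>h\<bar> powr - \<beta>) has_sum zeta \<beta>) {..-1}"
    using pos
    by (subst has_sum_reindex_bij_betw[symmetric, of uminus "{1..}"])
       (auto intro!: bij_betwI[of _ _ _ uminus])
  have "{1..} \<union> {..-1} = UNIV - {0::int}" by auto
  moreover have "{1..} \<inter> {..-1} = ({} :: int set)" by auto
  ultimately show ?thesis
    using has_sum_Un_disjoint[OF pos neg] by simp
qed

lemma zeta_nonneg: "\<beta> > 1 \<Longrightarrow> 0 \<le> zeta \<beta>"
  using zeta_has_sum by (rule has_sum_nonneg) auto

lemma sum_nonzero_int_le:
  assumes "\<beta> > 1" "finite B" "B \<subseteq> UNIV - {0}"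
  shows "(\<Sum>h\<in>B. real_of_int \<bar>h\<bar> powr - \<beta>) \<le> 2 * zeta \<beta>"
  by (rule finite_sum_le_has_sum[OF nonzero_int_has_sum]) (use assms in auto)

text \<open>Dividing by \<open>g\<close> pulls out the factor \<open>g powr - \<beta>\<close> and
  leaves distinct nonzero integers. This factor later pays for the up to \<open>g\<close> solutions
  of a linear congruence.\<close>

lemma sum_multiples_le:
  assumes "\<beta> > 1" "finite B" "B \<subseteq> UNIV - {0}" "g > 0" "\<And>h. h \<in> B \<Longrightarrow> g dvd h"
  shows "(\<Sum>h\<in>B. real_of_int \<bar>h\<bar> powr - \<beta>) \<le> real_of_int g powr - \<beta> * (2 * zeta \<beta>)"
proof -
  have "(\<Sum>h\<in>B. real_of_int \<bar>h\<bar> powr - \<beta>) =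
        (\<Sum>h\<in>B. real_of_int g powr - \<beta> * real_of_int \<bar>h div g\<bar> powr - \<beta>)"
  proof (rule sum.cong)
    fix h assume "h \<in> B"
    then obtain k where "h = g * k" using assms(5) by blast
    thus "real_of_int \<bar>h\<bar> powr - \<beta> = real_of_int g powr - \<beta> * real_of_int \<bar>h div g\<bar> powr - \<beta>"
      using \<open>g > 0\<close> by (simp add: abs_mult powr_mult)
  qed auto
  also have "\<dots> = real_of_int g powr - \<beta> * (\<Sum>h\<in>(\<lambda>h. h div g) ` B. real_of_int \<bar>h\<bar> powr - \<beta>)"
  proof -
    have "inj_on (\<lambda>h. h div g) B"
      by (rule inj_on_inverseI[of _ "\<lambda>k. k * g"]) (use assms(5) in auto)
    thus ?thesis by (simp add: sum.reindex sum_distrib_left)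
  qed
  also have "\<dots> \<le> real_of_int g powr - \<beta> * (2 * zeta \<beta>)"
  proof (intro mult_left_mono sum_nonzero_int_le assms)
    show "(\<lambda>h. h div g) ` B \<subseteq> UNIV - {0}"
      using assms(3,5) by (force simp: dvd_div_eq_0_iff)
  qed (use assms in auto)
  finally show ?thesis .
qed

text \<open>Lets a finite set of frequencies be enlarged to a product box, over which sums of
  products factor.\<close>

lemma finite_subset_PiE_box:
  assumes "finite u" "finite F" "F \<subseteq> u \<rightarrow>\<^sub>E A"
  obtains B where "finite B" "B \<subseteq> A" "F \<subseteq> u \<rightarrow>\<^sub>E B"
proof
  show "finite (\<Union>h\<in>F. h ` u)" using assms by auto
  show "(\<Union>h\<in>F. h ` u) \<subseteq> A" using assms(3) by auto
  show "F \<subseteq> u \<rightarrow>\<^sub>E (\<Union>h\<in>F. h ` u)" 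
  proof
    fix h assume "h \<in> F"
    moreover from this have "h \<in> extensional u" using assms(3) by (auto simp: PiE_def)
    ultimately show "h \<in> u \<rightarrow>\<^sub>E (\<Union>h\<in>F. h ` u)" by (auto simp: PiE_def)
  qed
qed

lemma sum_freq_weight_box:
  assumes "finite u" "finite B"
  shows "(\<Sum>h\<in>u \<rightarrow>\<^sub>E B. freq_weight \<beta> u h) = (\<Sum>h\<in>B. real_of_int \<bar>h\<bar> powr - \<beta>) ^ card u"
  unfolding freq_weight_def
  using prod_sum_PiE[of u "\<lambda>_. B" "\<lambda>_ h. real_of_int \<bar>h\<bar> powr - \<beta>"] assms by simp

lemma sum_freq_weight_le:
  assumes "\<beta> > 1" "finite u" "finite F" "F \<subseteq> u \<rightarrow>\<^sub>E (UNIV - {0})"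
  shows "(\<Sum>h\<in>F. freq_weight \<beta> u h) \<le> (2 * zeta \<beta>) ^ card u"
proof -
  obtain B where B: "finite B" "B \<subseteq> UNIV - {0}" "F \<subseteq> u \<rightarrow>\<^sub>E B"
    using finite_subset_PiE_box assms(2-4) .
  have "(\<Sum>h\<in>F. freq_weight \<beta> u h) \<le> (\<Sum>h\<in>u \<rightarrow>\<^sub>E B. freq_weight \<beta> u h)"
    using B assms(2) by (intro sum_mono2 finite_PiE freq_weight_nonneg) auto
  also have "\<dots> \<le> (2 * zeta \<beta>) ^ card u"
    unfolding sum_freq_weight_box[OF assms(2) B(1)]
    by (intro power_mono sum_nonzero_int_le assms B sum_nonneg) auto
  finally show ?thesis .
qed

lemma freq_weight_summable:
  assumes "\<beta> > 1" "finite u" "A \<subseteq> u \<rightarrow>\<^sub>E (UNIV - {0})"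
  shows "freq_weight \<beta> u summable_on A"
proof (rule nonneg_bdd_above_summable_on)
  show "bdd_above (sum (freq_weight \<beta> u) ` {F. F \<subseteq> A \<and> finite F})"
  proof (rule bdd_aboveI2)
    fix F assume "F \<in> {F. F \<subseteq> A \<and> finite F}"
    thus "sum (freq_weight \<beta> u) F \<le> (2 * zeta \<beta>) ^ card u"
      using assms by (intro sum_freq_weight_le) auto
  qed
qed (rule freq_weight_nonneg)

lemma dual_sum_nonneg: "0 \<le> dual_sum \<beta> N u \<xi>"
  unfolding dual_sum_def by (intro infsum_nonneg freq_weight_nonneg)

text \<open>This is what lets components outside \<open>u\<close> change during the search.\<close>

lemma dual_sum_cong:
  assumes "\<And>j. j \<in> u \<Longrightarrow> \<xi> j = \<xi>' j"
  shows "dual_sum \<beta> N u \<xi> = dual_sum \<beta> N u \<xi>'"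
proof -
  have "(\<Sum>j\<in>u. h j * \<xi> j) = (\<Sum>j\<in>u. h j * \<xi>' j)" for h
    using assms by (intro sum.cong) auto
  thus ?thesis by (simp add: dual_sum_def)
qed

lemma finite_unit_residues [simp]: "finite (unit_residues N)"
  unfolding unit_residues_def by (rule finite_subset[of _ "{1..int N - 1}"]) auto

subsection \<open>Averaging over the units modulo \<open>N\<close>\<close>

text \<open>If a unit \<open>z\<close> solves the congruence, then \<open>c\<close> is
  \<open>- h * z\<close> modulo \<open>N\<close>, and a unit factor does not change the gcd with
  \<open>N\<close>, so both gcds equal some \<open>g\<close>. Solutions agree modulo
  \<open>N div g\<close>, hence at most \<open>g\<close> of them lie below \<open>N\<close>.\<close>

lemma card_unit_solutions:
  assumes "N > 0"
  shows "card {z \<in> unit_residues N. int N dvd h * z + c} \<le>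
           (if gcd h (int N) = gcd c (int N) then nat (gcd c (int N)) else 0)"
proof (cases "{z \<in> unit_residues N. int N dvd h * z + c} = {}")
  case True
  show ?thesis by (subst True) auto
next
  case False
  let ?S = "{z \<in> unit_residues N. int N dvd h * z + c}"
  define g where "g = gcd h (int N)"
  have "g > 0" using assms by (simp add: g_def)
  obtain z0 where z0: "z0 \<in> ?S" using False by blast
  have "gcd c (int N) = gcd (h * z0) (int N)"
  proof -
    obtain k where "h * z0 + c = int N * k" using z0 by blast
    hence "c = - (h * z0) + k * int N" by (simp add: algebra_simps)
    thus ?thesis by (metis gcd.commute gcd_add_mult gcd_neg1 add.commute)
  qed
  also have "\<dots> = g"
    unfolding g_def using z0
    by (auto simp: unit_residues_def coprime_commute intro: gcd_mult_left_right_cancel)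
  finally have eq: "gcd c (int N) = g" .
  define n where "n = int N div g"
  have N: "int N = g * n" by (simp add: n_def g_def)
  have "n > 0" using assms N \<open>g > 0\<close> by (metis of_nat_0_less_iff zero_less_mult_pos)
  have n_dvd: "n dvd z - z'" if "z \<in> ?S" "z' \<in> ?S" for z z'
  proof -
    have "int N dvd (h * z + c) - (h * z' + c)" using that by (intro dvd_diff) auto
    hence "int N dvd h * (z - z')" by (simp add: algebra_simps)
    moreover obtain h' where h': "h = g * h'" unfolding g_def by (meson dvdE gcd_dvd1)
    ultimately have "n dvd h' * (z - z')" using N \<open>g > 0\<close> by (simp add: mult.assoc)
    moreover have "coprime n h'"
    proof -
      have "g * gcd h' n = g"
        using h' N \<open>g > 0\<close> by (metis g_def gcd_mult_distrib_int abs_of_pos)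
      thus ?thesis using \<open>g > 0\<close> by (simp add: coprime_iff_gcd_eq_1 gcd.commute)
    qed
    ultimately show ?thesis by (simp add: coprime_dvd_mult_right_iff)
  qed
  \<comment> \<open>Solutions share their residue modulo \<open>n\<close>, so the quotient by
    \<open>n\<close> determines them; it lies in \<open>{0..<g}\<close> because
    \<open>z < g * n\<close>.\<close>
  have "inj_on (\<lambda>z. z div n) ?S"
  proof (rule inj_onI)
    fix z z' assume "z \<in> ?S" "z' \<in> ?S" and div: "z div n = z' div n"
    hence "z mod n = z' mod n" using n_dvd by (simp add: mod_eq_dvd_iff)
    thus "z = z'" using div by (metis div_mult_mod_eq)
  qed
  hence "card ?S = card ((\<lambda>z. z div n) ` ?S)" by (simp add: card_image)
  also have "\<dots> \<le> card {0..<g}"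
  proof (intro card_mono image_subsetI)
    fix z assume "z \<in> ?S"
    hence "0 \<le> z" "z < g * n" using N by (auto simp: unit_residues_def)
    have "z div n * n < g * n"
      using \<open>z < g * n\<close> \<open>n > 0\<close>
      by (metis order.strict_trans1 div_mult_mod_eq le_add_same_cancel1 pos_mod_sign)
    hence "z div n < g" using \<open>n > 0\<close> by simp
    thus "z div n \<in> {0..<g}" using \<open>0 \<le> z\<close> \<open>n > 0\<close> by (simp add: pos_imp_zdiv_nonneg_iff)
  qed auto
  finally show ?thesis using eq by (simp add: g_def)
qed

text \<open>Only frequencies with \<open>gcd h N = g\<close> contribute, each with at most
  \<open>g\<close> solutions. They are multiples of \<open>g\<close>, so the total is at most
  \<open>g powr (1 - \<beta>) * (2 * zeta \<beta>)\<close>, and \<open>g\<close> is at least 1. The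
  bound is uniform in \<open>c\<close>.\<close>

lemma sum_unit_solutions_le:
  assumes "N > 0" "\<beta> > 1" "finite B" "B \<subseteq> UNIV - {0}"
  shows "(\<Sum>h\<in>B. real (card {z \<in> unit_residues N. int N dvd h * z + c}) * real_of_int \<bar>h\<bar> powr - \<beta>)
           \<le> 2 * zeta \<beta>"
proof -
  define g where "g = gcd c (int N)"
  have "g > 0" using assms by (simp add: g_def)
  have "(\<Sum>h\<in>B. real (card {z \<in> unit_residues N. int N dvd h * z + c}) * real_of_int \<bar>h\<bar> powr - \<beta>)
        \<le> (\<Sum>h\<in>B. if gcd h (int N) = g then real_of_int g * real_of_int \<bar>h\<bar> powr - \<beta> else 0)"
  proof (rule sum_mono)
    fix h
    have "real (card {z \<in> unit_residues N. int N dvd h * z + c}) \<le>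
        (if gcd h (int N) = g then real_of_int g else 0)"
      using card_unit_solutions[OF assms(1), of h c] \<open>g > 0\<close>
      by (auto simp: g_def le_nat_iff split: if_splits)
    from mult_right_mono[OF this, of "real_of_int \<bar>h\<bar> powr - \<beta>"]
    show "real (card {z \<in> unit_residues N. int N dvd h * z + c}) * real_of_int \<bar>h\<bar> powr - \<beta>
          \<le> (if gcd h (int N) = g then real_of_int g * real_of_int \<bar>h\<bar> powr - \<beta> else 0)"
      by (auto split: if_splits)
  qed
  also have "\<dots> = real_of_int g * (\<Sum>h\<in>{h\<in>B. gcd h (int N) = g}. real_of_int \<bar>h\<bar> powr - \<beta>)"
    using assms(3) by (simp add: sum.If_cases sum_distrib_left Int_def)
  also have "\<dots> \<le> real_of_int g * (real_of_int g powr - \<beta> * (2 * zeta \<beta>))"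
    using assms \<open>g > 0\<close> by (intro mult_left_mono sum_multiples_le) auto
  also have "\<dots> = real_of_int g powr (1 - \<beta>) * (2 * zeta \<beta>)"
    using \<open>g > 0\<close> by (simp add: powr_diff powr_minus field_simps)
  also have "\<dots> \<le> 1 * (2 * zeta \<beta>)"
    using zeta_nonneg[OF assms(2)] \<open>g > 0\<close> assms(2)
    by (intro mult_right_mono) (auto intro: order_trans[OF powr_mono[of "1 - \<beta>" 0]])
  finally show ?thesis by simp
qed

text \<open>After exchanging the sums, each frequency is weighted by the number of units
  \<open>y\<close> whose dual set contains it. The sum over the coordinate \<open>h d\<close> is
  then controlled by \<open>sum_unit_solutions_le\<close>, whatever the other coordinates are, and
  these contribute the remaining \<open>card u - 1\<close> factors.\<close>

lemma sum_dual_sum_le: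
  assumes "N > 0" "\<beta> > 1" "finite u" "d \<in> u"
  shows "(\<Sum>y\<in>unit_residues N. dual_sum \<beta> N u (\<xi>(d := y))) \<le> (2 * zeta \<beta>) ^ card u"
proof -
  let ?P = "u \<rightarrow>\<^sub>E (UNIV - {0 :: int})" and ?U = "unit_residues N"
  let ?v = "u - {d}"
  let ?D = "\<lambda>y. {h. int N dvd (\<Sum>j\<in>u. h j * (\<xi>(d := y)) j)}"
  define k where "k h = real (card {y \<in> ?U. h \<in> ?D y})" for h
  have split: "(\<Sum>j\<in>u. h j * (\<xi>(d := y)) j) = h d * y + (\<Sum>j\<in>?v. h j * \<xi> j)" for h y
    using assms by (subst sum.remove[of _ d]) (auto intro!: sum.cong)
  have sm: "(\<lambda>h. if h \<in> ?D y then freq_weight \<beta> u h else 0) summable_on ?P" for y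
    by (rule summable_on_comparison_test[OF freq_weight_summable[OF assms(2,3) order.refl]])
       (auto simp: freq_weight_nonneg)
  have "dual_sum \<beta> N u (\<xi>(d := y)) = (\<Sum>\<^sub>\<infinity>h\<in>?P. if h \<in> ?D y then freq_weight \<beta> u h else 0)" for y
    unfolding dual_sum_def by (rule infsum_cong_neutral) auto
  hence "(\<Sum>y\<in>?U. dual_sum \<beta> N u (\<xi>(d := y))) =
        (\<Sum>\<^sub>\<infinity>h\<in>?P. \<Sum>y\<in>?U. if h \<in> ?D y then freq_weight \<beta> u h else 0)"
    using infsum_finite_sum[of ?U "\<lambda>y h. if h \<in> ?D y then freq_weight \<beta> u h else 0" ?P] sm by simp
  also have "\<dots> = (\<Sum>\<^sub>\<infinity>h\<in>?P. k h * freq_weight \<beta> u h)"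
    unfolding k_def by (intro infsum_cong) (simp add: sum.If_cases Int_def)
  also have "\<dots> \<le> (2 * zeta \<beta>) ^ card u"
  proof (rule infsum_le_finite_sums)
    have "(\<lambda>h. \<Sum>y\<in>?U. if h \<in> ?D y then freq_weight \<beta> u h else 0) summable_on ?P"
      using sm by (intro has_sum_imp_summable[OF has_sum_finite_sum[OF finite_unit_residues has_sum_infsum]])
    thus "(\<lambda>h. k h * freq_weight \<beta> u h) summable_on ?P"
      unfolding k_def by (simp add: sum.If_cases Int_def)
  next
    fix F assume F: "finite F" "F \<subseteq> ?P"
    \<comment> \<open>A finite partial sum is dominated by the sum over a full box, where the
      coordinate \<open>d\<close> can be split off.\<close>
    obtain B where B: "finite B" "B \<subseteq> UNIV - {0}" "F \<subseteq> u \<rightarrow>\<^sub>E B"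
      using finite_subset_PiE_box assms(3) F .
    have u: "u = insert d ?v" using assms by auto
    have inj: "inj_on (\<lambda>(a, g). g(d := a)) (B \<times> (?v \<rightarrow>\<^sub>E B))"
      using inj_combinator[of d ?v "\<lambda>_. B"] by simp
    have "(\<Sum>h\<in>F. k h * freq_weight \<beta> u h) \<le> (\<Sum>h\<in>u \<rightarrow>\<^sub>E B. k h * freq_weight \<beta> u h)"
      using B assms(3)
      by (intro sum_mono2 finite_PiE mult_nonneg_nonneg freq_weight_nonneg) (auto simp: k_def)
    also have "u \<rightarrow>\<^sub>E B = (\<lambda>(a, g). g(d := a)) ` (B \<times> (?v \<rightarrow>\<^sub>E B))"
      by (subst u, rule PiE_insert_eq)
    also have "(\<Sum>h\<in>\<dots>. k h * freq_weight \<beta> u h) =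
       (\<Sum>(a, g)\<in>B \<times> (?v \<rightarrow>\<^sub>E B). k (g(d := a)) * freq_weight \<beta> u (g(d := a)))"
      by (subst sum.reindex[OF inj]) (simp add: case_prod_unfold)
    also have "\<dots> = (\<Sum>g\<in>?v \<rightarrow>\<^sub>E B. \<Sum>a\<in>B. k (g(d := a)) * freq_weight \<beta> u (g(d := a)))"
      by (subst sum.cartesian_product[symmetric], rule sum.swap)
    also have "\<dots> = (\<Sum>g\<in>?v \<rightarrow>\<^sub>E B. freq_weight \<beta> ?v g *
        (\<Sum>a\<in>B. real (card {y \<in> ?U. int N dvd a * y + (\<Sum>j\<in>?v. g j * \<xi> j)}) * real_of_int \<bar>a\<bar> powr - \<beta>))"
    proof (rule sum.cong[OF refl], unfold sum_distrib_left, rule sum.cong[OF refl])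
      fix g a
      have "freq_weight \<beta> u (g(d := a)) = real_of_int \<bar>a\<bar> powr - \<beta> * freq_weight \<beta> ?v g"
        unfolding freq_weight_def using assms by (subst prod.remove[of _ d]) (auto intro!: prod.cong)
      moreover have "(\<Sum>j\<in>?v. (g(d := a)) j * \<xi> j) = (\<Sum>j\<in>?v. g j * \<xi> j)"
        by (rule sum.cong) auto
      ultimately show "k (g(d := a)) * freq_weight \<beta> u (g(d := a)) = freq_weight \<beta> ?v g *
         (real (card {y \<in> ?U. int N dvd a * y + (\<Sum>j\<in>?v. g j * \<xi> j)}) * real_of_int \<bar>a\<bar> powr - \<beta>)"
        unfolding k_def mem_Collect_eq split by simp
    qed
    \<comment> \<open>For fixed \<open>g\<close> the other coordinates only enter the congruence
      through its constant term.\<close>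
    also have "\<dots> \<le> (\<Sum>g\<in>?v \<rightarrow>\<^sub>E B. freq_weight \<beta> ?v g * (2 * zeta \<beta>))"
      by (intro sum_mono mult_left_mono sum_unit_solutions_le assms B freq_weight_nonneg)
    also have "\<dots> = (\<Sum>g\<in>?v \<rightarrow>\<^sub>E B. freq_weight \<beta> ?v g) * (2 * zeta \<beta>)"
      by (rule sum_distrib_right[symmetric])
    also have "\<dots> \<le> (2 * zeta \<beta>) ^ card ?v * (2 * zeta \<beta>)"
      using assms B zeta_nonneg[OF assms(2)]
      by (intro mult_right_mono sum_freq_weight_le finite_PiE PiE_mono) auto
    also have "\<dots> = (2 * zeta \<beta>) ^ card u"
    proof -
      have "card u = Suc (card ?v)" using assms by (intro card.remove) auto
      thus ?thesis by simp
    qed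
    finally show "(\<Sum>h\<in>F. k h * freq_weight \<beta> u h) \<le> (2 * zeta \<beta>) ^ card u" .
  qed
  finally show ?thesis .
qed

text \<open>The totient of \<open>b ^ m\<close> is \<open>b ^ (m - 1) * (b - 1)\<close>, and
  \<open>b \<le> 2 * (b - 1)\<close>. This is the source of the leading factor 2 in the error
  bound.\<close>

lemma card_unit_residues_ge:
  assumes "prime b" "m \<ge> 1"
  shows "real (b ^ m) \<le> 2 * real (card (unit_residues (b ^ m)))"
proof -
  let ?N = "b ^ m"
  have "b \<ge> 2" using assms prime_ge_2_nat by blast
  hence "?N > 1" using assms by (intro one_less_power) auto
  have "unit_residues ?N = int ` totatives ?N"
  proof (intro equalityI subsetI)
    fix z assume z: "z \<in> unit_residues ?N"
    hence "nat z \<in> totatives ?N"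
      unfolding unit_residues_def in_totatives_iff
      by (auto simp: nat_le_iff coprime_int_iff[symmetric] simp del: of_nat_power)
    thus "z \<in> int ` totatives ?N" using z by (force simp: unit_residues_def)
  next
    fix z assume "z \<in> int ` totatives ?N"
    then obtain k where k: "z = int k" "k > 0" "k \<le> ?N" "coprime k ?N" by (auto simp: in_totatives_iff)
    \<comment> \<open>\<open>totatives\<close> allows the value \<open>?N\<close> itself,
      \<open>unit_residues\<close> stops at \<open>?N - 1\<close>; the two agree because a number
      above 1 is not coprime to itself.\<close>
    have "k \<noteq> ?N" using k \<open>?N > 1\<close> by auto
    hence "int k \<le> int ?N - 1" using k by linarith
    thus "z \<in> unit_residues ?N" using k unfolding unit_residues_def
      by (auto simp: coprime_int_iff simp del: of_nat_power)
  qed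
  hence card: "card (unit_residues ?N) = totient ?N"
    by (simp add: card_image totient_def)
  have "totient ?N = b ^ (m - 1) * (b - 1)"
    using assms by (intro totient_prime_power) auto
  moreover have "b \<le> 2 * (b - 1)" using \<open>b \<ge> 2\<close> by auto
  hence "b ^ (m - 1) * b \<le> b ^ (m - 1) * (2 * (b - 1))" by (rule mult_le_mono2)
  moreover have "b ^ (m - 1) * b = ?N" using assms by (intro power_minus_mult) simp
  ultimately have "?N \<le> 2 * card (unit_residues ?N)" unfolding card by (metis mult.left_commute)
  thus ?thesis by (metis of_nat_le_iff of_nat_mult of_nat_numeral)
qed

subsection \<open>Reproducing kernel Hilbert spaces\<close>

context reproducing_kernel_hilbert_space
begin

lemma diff_mem: "f \<in> V \<Longrightarrow> g \<in> V \<Longrightarrow> (\<lambda>x. f x - g x) \<in> V"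
  using add_mem[OF _ scale_mem[of g "-1"]] by simp

lemma sum_mem: "finite I \<Longrightarrow> (\<And>i. i \<in> I \<Longrightarrow> F i \<in> V) \<Longrightarrow> (\<lambda>x. \<Sum>i\<in>I. F i x) \<in> V"
  by (induction I rule: finite_induct) (auto intro: zero_mem add_mem)

lemma mean_mem:
  "finite I \<Longrightarrow> (\<And>i. i \<in> I \<Longrightarrow> F i \<in> V) \<Longrightarrow> (\<lambda>x. (\<Sum>i\<in>I. F i x) / c) \<in> V"
  using scale_mem[OF sum_mem, of I F "1 / c"] by simp

lemma ip_diff_left:
  assumes "f \<in> V" "g \<in> V" "h \<in> V"
  shows "ip (\<lambda>x. f x - g x) h = ip f h - ip g h"
  using ip_add_left[OF assms(1) scale_mem[OF assms(2)] assms(3), of "-1"]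
    ip_scale_left[OF assms(2,3), of "-1"] by simp

lemma ip_zero_left: "f \<in> V \<Longrightarrow> ip (\<lambda>x. 0) f = 0"
  using ip_scale_left[OF zero_mem, of f 0] by simp

lemma ip_sum_left:
  assumes "finite I" "\<And>i. i \<in> I \<Longrightarrow> F i \<in> V" "g \<in> V"
  shows "ip (\<lambda>x. \<Sum>i\<in>I. F i x) g = (\<Sum>i\<in>I. ip (F i) g)"
  using assms
  by (induction I rule: finite_induct) (auto simp: ip_zero_left ip_add_left sum_mem)

lemma ip_mean_left:
  assumes "finite I" "\<And>i. i \<in> I \<Longrightarrow> F i \<in> V" "g \<in> V"
  shows "ip (\<lambda>x. (\<Sum>i\<in>I. F i x) / c) g = (\<Sum>i\<in>I. ip (F i) g) / c"
  using ip_scale_left[OF sum_mem, of I F g "1 / c"] ip_sum_left[of I F g] assms by simp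

lemma ip_diff_right:
  assumes "f \<in> V" "g \<in> V" "h \<in> V"
  shows "ip h (\<lambda>x. f x - g x) = ip h f - ip h g"
proof -
  have "ip h (\<lambda>x. f x - g x) = cnj (ip (\<lambda>x. f x - g x) h)"
    by (rule ip_cnj) (use assms diff_mem in auto)
  also have "\<dots> = cnj (ip f h) - cnj (ip g h)"
    using assms by (simp add: ip_diff_left)
  also have "\<dots> = ip h f - ip h g"
    using assms ip_cnj by metis
  finally show ?thesis .
qed

text \<open>The divisor has the form \<open>of_nat c\<close> because it must survive the conjugation
  in the second argument.\<close>

lemma ip_mean_right:
  assumes "finite I" "\<And>i. i \<in> I \<Longrightarrow> F i \<in> V" "g \<in> V"
  shows "ip g (\<lambda>x. (\<Sum>i\<in>I. F i x) / of_nat c) = (\<Sum>i\<in>I. ip g (F i)) / of_nat c"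
proof -
  have "ip g (\<lambda>x. (\<Sum>i\<in>I. F i x) / of_nat c) = cnj ((\<Sum>i\<in>I. ip (F i) g) / of_nat c)"
    using assms by (subst ip_cnj[OF mean_mem]) (auto simp: ip_mean_left)
  also have "\<dots> = (\<Sum>i\<in>I. ip g (F i)) / of_nat c"
    using assms by (simp add: ip_cnj[of _ g] cong: sum.cong)
  finally show ?thesis .
qed

lemma hnorm_nonneg: "0 \<le> hnorm ip f"
  if "f \<in> V"
  unfolding hnorm_def using ip_nonneg that by simp

lemma ip_self: "f \<in> V \<Longrightarrow> ip f f = complex_of_real ((hnorm ip f)\<^sup>2)"
  unfolding hnorm_def using ip_nonneg[of f] ip_cnj[of f f]
  by (auto simp: complex_eq_iff)

lemma ip_zero_right: "f \<in> V \<Longrightarrow> ip f (\<lambda>x. 0) = 0"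
  using ip_cnj[OF zero_mem, of f] ip_zero_left by simp

lemma Cauchy_Schwarz:
  assumes "f \<in> V" "g \<in> V"
  shows "cmod (ip f g) \<le> hnorm ip f * hnorm ip g"
proof (cases "hnorm ip g = 0")
  case True
  hence "g = (\<lambda>x. 0)" using ip_self[of g] ip_definite[of g] assms by simp
  thus ?thesis using assms ip_zero_right hnorm_nonneg by simp
next
  case False
  define G where "G = (hnorm ip g)\<^sup>2"
  have "G > 0" using False by (simp add: G_def)
  obtain c where c: "c * of_real G = ip f g" "c = ip f g / of_real G"
    using \<open>G > 0\<close> by simp
  \<comment> \<open>The component of \<open>f\<close> orthogonal to \<open>g\<close>. Its squared
    norm is the squared norm of \<open>f\<close> minus \<open>(cmod (ip f g))\<^sup>2 / G\<close>,
    and this is nonnegative.\<close>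
  let ?r = "\<lambda>x. f x - c * g x"
  have cg: "(\<lambda>x. c * g x) \<in> V" using assms scale_mem by auto
  have r: "?r \<in> V" using assms cg diff_mem by auto
  have rg: "ip ?r g = 0"
    using assms cg c(1)
    by (simp add: ip_diff_left ip_scale_left ip_self[of g] del: of_real_power flip: G_def)
  have "ip ?r ?r = ip ?r f - ip ?r (\<lambda>x. c * g x)"
    using r assms cg by (intro ip_diff_right)
  also have "ip ?r (\<lambda>x. c * g x) = cnj (c * ip g ?r)"
    using assms r cg by (simp add: ip_cnj[of "\<lambda>x. c * g x" ?r] ip_scale_left)
  also have "ip g ?r = 0" using ip_cnj[OF r assms(2)] rg by simp
  also have "ip ?r f = ip f f - c * ip g f"
    using assms cg by (simp add: ip_diff_left ip_scale_left)
  also have "ip g f = cnj (ip f g)" by (rule ip_cnj[OF assms])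
  also have "c * cnj (ip f g) = of_real ((cmod (ip f g))\<^sup>2 / G)"
    unfolding c(2) using complex_norm_square[of "ip f g"] by simp
  finally have "0 \<le> (hnorm ip f)\<^sup>2 - (cmod (ip f g))\<^sup>2 / G"
    using ip_nonneg[OF r] assms by (simp add: ip_self[of f])
  hence "(cmod (ip f g))\<^sup>2 \<le> (hnorm ip f * hnorm ip g)\<^sup>2"
    using \<open>G > 0\<close> by (simp add: field_simps G_def power_mult_distrib)
  thus ?thesis using hnorm_nonneg assms by (meson mult_nonneg_nonneg power2_le_imp_le)
qed

lemma hnorm_diff_sq:
  assumes "f \<in> V" "g \<in> V"
  shows "(hnorm ip (\<lambda>x. f x - g x))\<^sup>2 = Re (ip f f - ip f g - ip g f + ip g g)"
proof -
  have "complex_of_real ((hnorm ip (\<lambda>x. f x - g x))\<^sup>2) = ip f f - ip f g - ip g f + ip g g"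
    using assms by (simp add: ip_self[symmetric] diff_mem ip_diff_left ip_diff_right del: of_real_power)
  thus ?thesis by (metis Re_complex_of_real)
qed

lemma kernel_ip:
  assumes "x \<in> X" "y \<in> X"
  shows "ip (kernel_section X K y) (kernel_section X K x) = K x y"
  using reproducing[OF kernel_mem[OF assms(2)] assms(1)] assms by (simp add: kernel_section_def)

text \<open>The difference of values is the inner product with a difference of kernel sections. In
  this way elements of \<open>V\<close> inherit continuity from the kernel.\<close>

lemma eval_diff_le:
  assumes "f \<in> V" "x \<in> X" "y \<in> X"
  shows "cmod (f x - f y) \<le> hnorm ip f * sqrt (Re (K x x - K x y - K y x + K y y))"
proof -
  let ?k = "kernel_section X K"
  have "f x - f y = ip f (\<lambda>t. ?k x t - ?k y t)"
    using assms kernel_mem reproducing[of f] by (simp add: ip_diff_right)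
  also have "cmod \<dots> \<le> hnorm ip f * hnorm ip (\<lambda>t. ?k x t - ?k y t)"
    using assms kernel_mem by (intro Cauchy_Schwarz diff_mem)
  also have "hnorm ip (\<lambda>t. ?k x t - ?k y t) = sqrt (Re (K x x - K x y - K y x + K y y))"
  proof -
    have "(hnorm ip (\<lambda>t. ?k x t - ?k y t))\<^sup>2 = Re (K x x - K x y - K y x + K y y)"
      using assms kernel_mem by (simp add: hnorm_diff_sq kernel_ip algebra_simps)
    thus ?thesis
      using assms kernel_mem hnorm_nonneg diff_mem by (metis real_sqrt_unique)
  qed
  finally show ?thesis .
qed

text \<open>Turns convergence in norm into pointwise convergence, and bounds \<open>f\<close>
  wherever the diagonal of the kernel is bounded.\<close>

lemma eval_le:
  assumes "f \<in> V" "x \<in> X"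
  shows "cmod (f x) \<le> hnorm ip f * sqrt (Re (K x x))"
proof -
  have "cmod (f x) \<le> hnorm ip f * hnorm ip (kernel_section X K x)"
    using assms kernel_mem by (metis Cauchy_Schwarz reproducing)
  also have "hnorm ip (kernel_section X K x) = sqrt (Re (K x x))"
    using assms by (simp add: hnorm_def kernel_ip)
  finally show ?thesis .
qed

text \<open>A functional represented by \<open>r\<close> has the norm of \<open>r\<close>:
  Cauchy-Schwarz bounds it from above, and the normalised \<open>r\<close> attains the
  bound.\<close>

lemma SUP_unit_ball:
  assumes "r \<in> V" "\<And>f. f \<in> V \<Longrightarrow> L f = ip f r"
  shows "(SUP f\<in>{f \<in> V. hnorm ip f \<le> 1}. cmod (L f)) = hnorm ip r"
proof (rule cSup_eq_maximum)
  have upper: "cmod (L f) \<le> hnorm ip r" if "f \<in> V" "hnorm ip f \<le> 1" for f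
  proof -
    have "cmod (L f) \<le> hnorm ip f * hnorm ip r"
      using assms that Cauchy_Schwarz by simp
    also have "\<dots> \<le> 1 * hnorm ip r"
      using that assms hnorm_nonneg by (intro mult_right_mono) auto
    finally show ?thesis by simp
  qed
  show "\<And>y. y \<in> (\<lambda>f. cmod (L f)) ` {f \<in> V. hnorm ip f \<le> 1} \<Longrightarrow> y \<le> hnorm ip r"
    using upper by auto
  define n where "n = hnorm ip r"
  \<comment> \<open>For \<open>n = 0\<close> the quotient \<open>1 / n\<close> is 0, so the
    maximiser becomes the zero function and both properties of \<open>c\<close> still hold.\<close>
  obtain c where c: "c * of_real n * of_real n = of_real n" "c = complex_of_real (1 / n)" by simp
  have n: "n \<ge> 0" using hnorm_nonneg assms by (simp add: n_def)
  let ?f = "\<lambda>x. c * r x"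
  have f: "?f \<in> V" using assms scale_mem by simp
  have fr: "ip ?f r = of_real n"
    using assms c(1) by (simp add: ip_scale_left ip_self power2_eq_square mult.assoc flip: n_def)
  have "ip ?f ?f = c * ip r ?f" using assms f by (simp add: ip_scale_left)
  also have "ip r ?f = cnj (of_real n)" using ip_cnj[OF f assms(1)] fr by simp
  finally have "hnorm ip ?f \<le> 1" unfolding hnorm_def c(2) by simp
  moreover have "cmod (L ?f) = n" using assms f fr n by simp
  ultimately show "hnorm ip r \<in> (\<lambda>f. cmod (L f)) ` {f \<in> V. hnorm ip f \<le> 1}"
    using f by (auto simp: n_def intro!: rev_image_eqI[of ?f])
qed

end

section \<open>Dominated convergence for series, and sums of roots of unity\<close>

text \<open>By the Weierstrass M-test the finite partial sums converge uniformly in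
  \<open>n\<close>, so the two limits may be exchanged. The filter is arbitrary because double
  sequences have to be covered as well.\<close>

lemma tendsto_infsum:
  fixes f :: "'n \<Rightarrow> 'a \<Rightarrow> 'b :: banach"
  assumes lim: "\<And>x. x \<in> A \<Longrightarrow> ((\<lambda>n. f n x) \<longlongrightarrow> g x) F"
    and bound: "\<And>n x. x \<in> A \<Longrightarrow> norm (f n x) \<le> M x"
    and M: "M summable_on A"
    and F: "F \<noteq> bot"
  shows "((\<lambda>n. \<Sum>\<^sub>\<infinity>x\<in>A. f n x) \<longlongrightarrow> (\<Sum>\<^sub>\<infinity>x\<in>A. g x)) F"
proof (rule swap_uniform_limit')
  show "uniform_limit UNIV (\<lambda>X n. \<Sum>x\<in>X. f n x) (\<lambda>n. \<Sum>\<^sub>\<infinity>x\<in>A. f n x) (finite_subsets_at_top A)"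
    by (rule Weierstrass_m_test_general[OF _ M]) (rule bound)
  have "norm (g x) \<le> M x" if "x \<in> A" for x
    by (rule tendsto_upperbound[OF tendsto_norm[OF lim[OF that]]]) (use bound that F in auto)
  hence "g summable_on A"
    by (intro abs_summable_summable[OF Infinite_Sum.abs_summable_on_comparison_test'[OF M]])
  thus "(sum g \<longlongrightarrow> (\<Sum>\<^sub>\<infinity>x\<in>A. g x)) (finite_subsets_at_top A)"
    by (rule infsum_tendsto)
  show "\<forall>\<^sub>F X in finite_subsets_at_top A. ((\<lambda>n. \<Sum>x\<in>X. f n x) \<longlongrightarrow> sum g X) F"
    by (rule eventually_finite_subsets_at_top_weakI) (intro tendsto_sum lim, auto)
qed auto

text \<open>A geometric sum over the powers of \<open>w\<close> with \<open>w ^ N = 1\<close>; it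
  vanishes unless \<open>w = 1\<close>, which means that \<open>N\<close> divides
  \<open>a\<close>.\<close>

lemma sum_cis_eq:
  assumes "N > 0"
  shows "(\<Sum>n<N. cis (2 * pi * (real n * real_of_int a / real N))) = (if int N dvd a then of_nat N else 0)"
proof -
  define w where "w = cis (2 * pi * (real_of_int a / real N))"
  have pow: "cis (2 * pi * (real n * real_of_int a / real N)) = w ^ n" for n
    unfolding w_def Complex.DeMoivre by (rule arg_cong[of _ _ cis]) simp
  have wN: "w ^ N = 1"
    using assms cis_multiple_2pi[of "real_of_int a"] by (simp add: pow[symmetric])
  have "w = 1 \<longleftrightarrow> int N dvd a"
  proof
    assume "w = 1"
    then obtain n :: int where "2 * pi * (real_of_int a / real N) = of_int (2 * n) * pi"
      unfolding w_def cis_conv_exp exp_eq_1 by auto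
    hence "real_of_int a = real_of_int (n * int N)" using assms by (simp add: field_simps)
    hence "a = n * int N" by (simp only: of_int_eq_iff)
    thus "int N dvd a" by simp
  next
    assume "int N dvd a"
    then obtain k where "a = int N * k" by blast
    thus "w = 1" using assms cis_multiple_2pi[of "real_of_int k"] by (simp add: w_def)
  qed
  thus ?thesis unfolding pow using wN geometric_sum[of w N] by auto
qed

subsection \<open>Kernel series and means of characters\<close>

definition fourier_char :: "nat set \<Rightarrow> (nat \<Rightarrow> int) \<Rightarrow> (nat \<Rightarrow> real) \<Rightarrow> complex" where
  "fourier_char u h x = cis (2 * pi * (\<Sum>j\<in>u. real_of_int (h j) * x j))"

text \<open>
  The kernel, its means over point sets and the inner products of such means are all of this form,
  with \<open>\<phi>\<close> a product of means of characters.
\<close>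

definition korobov_series ::
  "real \<Rightarrow> (nat set \<Rightarrow> real) \<Rightarrow> nat \<Rightarrow> (nat set \<Rightarrow> (nat \<Rightarrow> int) \<Rightarrow> complex) \<Rightarrow> complex" where
  "korobov_series \<alpha> \<gamma> s \<phi> = 1 + (\<Sum>u\<in>Pow {1..s} - {{}}. complex_of_real (\<gamma> u) *
     (\<Sum>\<^sub>\<infinity>h\<in>u \<rightarrow>\<^sub>E (UNIV - {0}). \<phi> u h * complex_of_real (freq_weight \<alpha> u h)))"

lemma norm_fourier_char [simp]: "cmod (fourier_char u h x) = 1"
  by (simp add: fourier_char_def)

lemma fourier_char_mult_cnj [simp]: "fourier_char u h x * cnj (fourier_char u h x) = 1"
  by (simp add: fourier_char_def cis_cnj cis_mult)

lemma norm_mean_le: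
  fixes f :: "'i \<Rightarrow> complex"
  assumes "\<And>i. i \<in> I \<Longrightarrow> cmod (f i) \<le> 1"
  shows "cmod ((\<Sum>i\<in>I. f i) / of_nat (card I)) \<le> 1"
proof -
  have "cmod (\<Sum>i\<in>I. f i) \<le> real (card I)"
    using sum_norm_le[of I f "\<lambda>_. 1"] assms by simp
  thus ?thesis by (cases "card I = 0") (auto simp: norm_divide)
qed

text \<open>The exponential of a difference splits into a factor in \<open>x\<close> and a
  conjugated factor in \<open>y\<close>, so means can be taken in each argument separately.\<close>

lemma korobov_kernel_eq:
  "korobov_kernel \<alpha> \<gamma> s x y =
     korobov_series \<alpha> \<gamma> s (\<lambda>u h. fourier_char u h x * cnj (fourier_char u h y))"
proof -
  have "exp (2 * complex_of_real pi * \<i> * complex_of_real (\<Sum>j\<in>u. real_of_int (h j) * (x j - y j)))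
          / complex_of_real (\<Prod>j\<in>u. real_of_int \<bar>h j\<bar> powr \<alpha>) =
        fourier_char u h x * cnj (fourier_char u h y) * complex_of_real (freq_weight \<alpha> u h)" for u h
  proof -
    have "fourier_char u h x * cnj (fourier_char u h y) =
          cis (2 * pi * (\<Sum>j\<in>u. real_of_int (h j) * (x j - y j)))"
      by (simp add: fourier_char_def cis_cnj cis_mult right_diff_distrib sum_subtractf)
    also have "\<dots> = exp (2 * complex_of_real pi * \<i> * complex_of_real (\<Sum>j\<in>u. real_of_int (h j) * (x j - y j)))"
      unfolding cis_conv_exp by (rule arg_cong[of _ _ exp]) simp
    finally have "fourier_char u h x * cnj (fourier_char u h y) = \<dots>" .
    moreover have "freq_weight \<alpha> u h = inverse (\<Prod>j\<in>u. real_of_int \<bar>h j\<bar> powr \<alpha>)"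
      unfolding freq_weight_def powr_minus using prod_inversef[of _ u] by (simp add: comp_def)
    ultimately show ?thesis by (simp only: divide_inverse of_real_inverse)
  qed
  thus ?thesis unfolding korobov_kernel_def korobov_series_def by simp
qed

context
  fixes \<alpha> :: real and u :: "nat set"
  assumes \<alpha>: "\<alpha> > 1" and u: "finite u"
begin

lemma freq_series_summable:
  assumes "\<And>h. cmod (c h) \<le> 1"
  shows "(\<lambda>h. c h * complex_of_real (freq_weight \<alpha> u h)) summable_on (u \<rightarrow>\<^sub>E (UNIV - {0}))"
proof (rule abs_summable_summable[OF Infinite_Sum.abs_summable_on_comparison_test'])
  show "freq_weight \<alpha> u summable_on (u \<rightarrow>\<^sub>E (UNIV - {0}))"
    using freq_weight_summable[OF \<alpha> u] by simp
  show "cmod (c h * complex_of_real (freq_weight \<alpha> u h)) \<le> freq_weight \<alpha> u h" for h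
    using mult_right_mono[OF assms[of h] freq_weight_nonneg[of \<alpha> u h]] freq_weight_nonneg[of \<alpha> u h]
    by (simp add: norm_mult)
qed

lemma freq_series_tendsto:
  assumes "\<And>h. h \<in> u \<rightarrow>\<^sub>E (UNIV - {0}) \<Longrightarrow> ((\<lambda>n. c n h) \<longlongrightarrow> c' h) F"
    and "\<And>n h. cmod (c n h) \<le> 1" and "F \<noteq> bot"
  shows "((\<lambda>n. \<Sum>\<^sub>\<infinity>h\<in>u \<rightarrow>\<^sub>E (UNIV - {0}). c n h * complex_of_real (freq_weight \<alpha> u h)) \<longlongrightarrow>
           (\<Sum>\<^sub>\<infinity>h\<in>u \<rightarrow>\<^sub>E (UNIV - {0}). c' h * complex_of_real (freq_weight \<alpha> u h))) F"
proof (rule tendsto_infsum)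
  show "freq_weight \<alpha> u summable_on (u \<rightarrow>\<^sub>E (UNIV - {0}))"
    using freq_weight_summable[OF \<alpha> u] by simp
  show "cmod (c n h * complex_of_real (freq_weight \<alpha> u h)) \<le> freq_weight \<alpha> u h" for n h
    using mult_right_mono[OF assms(2)[of n h] freq_weight_nonneg[of \<alpha> u h]] freq_weight_nonneg[of \<alpha> u h]
    by (simp add: norm_mult)
qed (use assms in \<open>auto intro!: tendsto_intros\<close>)

end

text \<open>Convergence of the single coefficients is enough, since the summable weights
  \<open>freq_weight \<alpha> u\<close> dominate all series.\<close>

lemma korobov_series_tendsto:
  assumes "\<alpha> > 1" "F \<noteq> bot" "\<And>n u h. cmod (\<phi> n u h) \<le> 1"
    and "\<And>u h. u \<subseteq> {1..s} \<Longrightarrow> u \<noteq> {} \<Longrightarrow> h \<in> u \<rightarrow>\<^sub>E (UNIV - {0}) \<Longrightarrow> ((\<lambda>n. \<phi> n u h) \<longlongrightarrow> \<psi> u h) F"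
  shows "((\<lambda>n. korobov_series \<alpha> \<gamma> s (\<phi> n)) \<longlongrightarrow> korobov_series \<alpha> \<gamma> s \<psi>) F"
  unfolding korobov_series_def
  by (intro tendsto_intros freq_series_tendsto)
     (use assms in \<open>auto intro: finite_subset[OF _ finite_atLeastAtMost]\<close>)

text \<open>The series is affine in its coefficients, and the mean of the constant terms is again 1
  because \<open>I\<close> is nonempty.\<close>

lemma korobov_series_mean:
  assumes "\<alpha> > 1" "finite I" "I \<noteq> {}" "\<And>i u h. cmod (\<phi> i u h) \<le> 1"
  shows "(\<Sum>i\<in>I. korobov_series \<alpha> \<gamma> s (\<phi> i)) / of_nat (card I) =
           korobov_series \<alpha> \<gamma> s (\<lambda>u h. (\<Sum>i\<in>I. \<phi> i u h) / of_nat (card I))"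
proof -
  define c :: complex where "c = of_nat (card I)"
  have "c \<noteq> 0" using assms by (simp add: c_def)
  let ?P = "\<lambda>u. u \<rightarrow>\<^sub>E (UNIV - {0 :: int})"
  let ?w = "\<lambda>u h. complex_of_real (freq_weight \<alpha> u h)"
  have inner: "(\<Sum>\<^sub>\<infinity>h\<in>?P u. (\<Sum>i\<in>I. \<phi> i u h) / c * ?w u h) = (\<Sum>i\<in>I. \<Sum>\<^sub>\<infinity>h\<in>?P u. \<phi> i u h * ?w u h) / c"
    if "u \<in> Pow {1..s} - {{}}" for u
  proof -
    have u: "finite u" using that finite_subset[of u "{1..s}"] by auto
    have "((\<lambda>h. (\<Sum>i\<in>I. \<phi> i u h * ?w u h) / c) has_sum (\<Sum>i\<in>I. \<Sum>\<^sub>\<infinity>h\<in>?P u. \<phi> i u h * ?w u h) / c) (?P u)"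
      unfolding divide_inverse
      using assms u by (intro has_sum_cmult_left has_sum_finite_sum has_sum_infsum freq_series_summable)
    thus ?thesis by (simp add: infsumI sum_distrib_right)
  qed
  have "(\<Sum>i\<in>I. korobov_series \<alpha> \<gamma> s (\<phi> i)) / c =
        1 + (\<Sum>i\<in>I. \<Sum>u\<in>Pow {1..s} - {{}}. of_real (\<gamma> u) * (\<Sum>\<^sub>\<infinity>h\<in>?P u. \<phi> i u h * ?w u h)) / c"
    using \<open>c \<noteq> 0\<close> unfolding korobov_series_def by (simp add: sum.distrib add_divide_distrib c_def)
  also have "(\<Sum>i\<in>I. \<Sum>u\<in>Pow {1..s} - {{}}. of_real (\<gamma> u) * (\<Sum>\<^sub>\<infinity>h\<in>?P u. \<phi> i u h * ?w u h)) / c =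
        (\<Sum>u\<in>Pow {1..s} - {{}}. of_real (\<gamma> u) * ((\<Sum>i\<in>I. \<Sum>\<^sub>\<infinity>h\<in>?P u. \<phi> i u h * ?w u h) / c))"
    by (subst sum.swap) (simp add: sum_divide_distrib sum_distrib_left)
  also have "\<dots> = (\<Sum>u\<in>Pow {1..s} - {{}}. of_real (\<gamma> u) * (\<Sum>\<^sub>\<infinity>h\<in>?P u. (\<Sum>i\<in>I. \<phi> i u h) / c * ?w u h))"
    using inner by (intro sum.cong) auto
  finally show ?thesis unfolding korobov_series_def c_def .
qed

section \<open>Characters on lattice points and on regular grids\<close>

text \<open>Taking fractional parts changes the phase by an integer combination of integers, which
  \<open>cis\<close> does not see.\<close>

lemma fourier_char_lattice_point:
  assumes "u \<subseteq> {1..s}"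
  shows "fourier_char u h (lattice_point N s \<xi> n) =
           cis (2 * pi * (real n * real_of_int (\<Sum>j\<in>u. h j * \<xi> j) / real N))"
proof -
  let ?k = "\<Sum>j\<in>u. h j * \<lfloor>real n * real_of_int (\<xi> j) / real N\<rfloor>"
  have "(\<Sum>j\<in>u. real_of_int (h j) * lattice_point N s \<xi> n j) =
        (\<Sum>j\<in>u. real_of_int (h j) * (real n * real_of_int (\<xi> j) / real N) -
                real_of_int (h j * \<lfloor>real n * real_of_int (\<xi> j) / real N\<rfloor>))"
    using assms by (intro sum.cong) (auto simp: lattice_point_def frac_def right_diff_distrib)
  also have "\<dots> = real n * real_of_int (\<Sum>j\<in>u. h j * \<xi> j) / real N - real_of_int ?k"
    by (simp add: sum_subtractf sum_distrib_left sum_divide_distrib mult_ac)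
  finally have "fourier_char u h (lattice_point N s \<xi> n) =
      cis (2 * pi * (real n * real_of_int (\<Sum>j\<in>u. h j * \<xi> j) / real N)) / cis (2 * pi * real_of_int ?k)"
    unfolding fourier_char_def cis_divide by (simp only: right_diff_distrib)
  also have "cis (2 * pi * real_of_int ?k) = 1"
    by (rule cis_multiple_2pi) (rule Ints_of_int)
  finally show ?thesis by simp
qed

lemma fourier_char_lattice_mean:
  assumes "u \<subseteq> {1..s}" "N > 0"
  shows "(\<Sum>n<N. fourier_char u h (lattice_point N s \<xi> n)) / of_nat N =
           (if int N dvd (\<Sum>j\<in>u. h j * \<xi> j) then 1 else 0)"
  unfolding fourier_char_lattice_point[OF assms(1)] sum_cis_eq[OF assms(2)] using assms by simp

lemma lattice_point_in_cube: "lattice_point N s \<xi> n \<in> unit_cube s"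
  unfolding lattice_point_def unit_cube_def
  by (auto simp: less_imp_le[OF frac_lt_1])

definition grid_point :: "nat \<Rightarrow> nat \<Rightarrow> (nat \<Rightarrow> nat) \<Rightarrow> nat \<Rightarrow> real" where
  "grid_point s n k = (\<lambda>j\<in>{1..s}. real (k j) / real (Suc n))"

lemma grid_point_in_cube: "(\<And>j. j \<in> {1..s} \<Longrightarrow> k j \<le> Suc n) \<Longrightarrow> grid_point s n k \<in> unit_cube s"
  unfolding grid_point_def unit_cube_def by (auto simp: field_simps simp flip: of_nat_Suc)

text \<open>Only left endpoints are used, so in each coordinate the points are the multiples of
  \<open>1 / Suc n\<close> modulo 1, and character sums over them are complete sums over roots of
  unity.\<close>

definition grid :: "nat \<Rightarrow> nat \<Rightarrow> (nat \<Rightarrow> nat) set" where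
  "grid s n = {1..s} \<rightarrow>\<^sub>E {..<Suc n}"

lemma grid_finite: "finite (grid s n)" and grid_nonempty: "grid s n \<noteq> {}"
  and card_grid: "card (grid s n) = Suc n ^ s"
  unfolding grid_def by (auto intro: finite_PiE simp: PiE_eq_empty_iff card_funcsetE)

text \<open>The sum over the product grid factors into one-dimensional sums, and the one for the
  coordinate \<open>j\<close> vanishes.\<close>

lemma grid_sum_fourier_char:
  assumes "u \<subseteq> {1..s}" "j \<in> u" "\<not> int (Suc n) dvd h j"
  shows "(\<Sum>k\<in>grid s n. fourier_char u h (grid_point s n k)) = 0"
proof -
  \<comment> \<open>Coordinates outside \<open>u\<close> get the factor 1, so that the product runs
    over all of \<open>{1..s}\<close> as the grid does.\<close>
  let ?c = "\<lambda>j k. if j \<in> u then cis (2 * pi * (real k * real_of_int (h j) / real (Suc n))) else 1"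
  have "fourier_char u h (grid_point s n k) = (\<Prod>j\<in>{1..s}. ?c j (k j))" for k
  proof -
    have fin: "finite u" using assms(1) finite_subset by blast
    have "fourier_char u h (grid_point s n k) =
          cis (\<Sum>j\<in>u. 2 * pi * (real (k j) * real_of_int (h j) / real (Suc n)))"
      unfolding fourier_char_def sum_distrib_left
      using assms(1) by (intro arg_cong[of _ _ cis] sum.cong) (auto simp: grid_point_def)
    also have "\<dots> = (\<Prod>j\<in>u. cis (2 * pi * (real (k j) * real_of_int (h j) / real (Suc n))))"
      using fin unfolding cis_conv_exp of_real_sum sum_distrib_left by (rule exp_sum)
    also have "\<dots> = (\<Prod>j\<in>{1..s}. ?c j (k j))"
      using assms(1) by (intro prod.mono_neutral_cong_left) auto
    finally show ?thesis .
  qed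
  hence "(\<Sum>k\<in>grid s n. fourier_char u h (grid_point s n k)) = (\<Prod>j\<in>{1..s}. \<Sum>k<Suc n. ?c j k)"
    unfolding grid_def by (subst prod_sum_PiE) auto
  also have "\<dots> = 0"
  proof (rule prod_zero)
    have "(\<Sum>k<Suc n. ?c j k) = 0"
      using sum_cis_eq[of "Suc n" "h j"] assms by simp
    thus "\<exists>j\<in>{1..s}. (\<Sum>k<Suc n. ?c j k) = 0" using assms by blast
  qed simp
  finally show ?thesis .
qed

lemma eventually_not_dvd:
  fixes a :: int
  assumes "a \<noteq> 0"
  shows "eventually (\<lambda>n. \<not> int (Suc n) dvd a) sequentially"
proof (rule eventually_sequentiallyI)
  fix n assume "nat \<bar>a\<bar> \<le> n"
  thus "\<not> int (Suc n) dvd a" using assms zdvd_not_zless[of "\<bar>a\<bar>" "int (Suc n)"] by simp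
qed

definition grid_mean_char :: "nat \<Rightarrow> nat set \<Rightarrow> (nat \<Rightarrow> int) \<Rightarrow> nat \<Rightarrow> complex" where
  "grid_mean_char s u h n = (\<Sum>k\<in>grid s n. fourier_char u h (grid_point s n k)) / of_nat (card (grid s n))"

lemma norm_grid_mean_char: "cmod (grid_mean_char s u h n) \<le> 1"
  unfolding grid_mean_char_def by (rule norm_mean_le) simp

text \<open>Once \<open>Suc n\<close> exceeds the absolute value of a nonzero \<open>h j\<close>, it
  cannot divide \<open>h j\<close>. The means then vanish exactly, not merely in the limit.\<close>

lemma eventually_grid_mean_char_eq_0:
  assumes "u \<subseteq> {1..s}" "u \<noteq> {}" "h \<in> u \<rightarrow>\<^sub>E (UNIV - {0})"
  shows "eventually (\<lambda>n. grid_mean_char s u h n = 0) sequentially"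
proof -
  obtain j where j: "j \<in> u" using assms by blast
  hence "h j \<noteq> 0" using assms by auto
  from eventually_not_dvd[OF this] show ?thesis
    by (rule eventually_mono) (simp add: grid_mean_char_def grid_sum_fourier_char[OF assms(1) j])
qed

subsection \<open>The integral as an inner product\<close>

text \<open>Defined through the rounding index, so that lying in a box says which grid point
  \<open>round_down\<close> selects; \<open>cell_eq\<close> gives the interval form.\<close>

definition cell :: "nat \<Rightarrow> nat \<Rightarrow> real set" where
  "cell n i = {t \<in> {0..1}. nat \<lfloor>real (Suc n) * t\<rfloor> = i}"

abbreviation unit_measure :: "real measure" where
  "unit_measure \<equiv> restrict_space lborel {0..1}"

lemma cell_eq:
  "cell n i = {0..1} \<inter> {real i / real (Suc n)..<real (Suc i) / real (Suc n)}"
proof -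
  have "nat \<lfloor>real (Suc n) * t\<rfloor> = i \<longleftrightarrow> real i / real (Suc n) \<le> t \<and> t < real (Suc i) / real (Suc n)"
    if "t \<ge> 0" for t
  proof -
    have "0 \<le> real (Suc n) * t" using that by simp
    hence "nat \<lfloor>real (Suc n) * t\<rfloor> = i \<longleftrightarrow> \<lfloor>real (Suc n) * t\<rfloor> = int i"
      by (metis int_nat_eq nat_int zero_le_floor)
    also have "\<dots> \<longleftrightarrow> real i \<le> real (Suc n) * t \<and> real (Suc n) * t < real (Suc i)"
      by (simp add: floor_eq_iff add.commute)
    finally show ?thesis
      by (simp only: pos_divide_le_eq pos_less_divide_eq of_nat_0_less_iff zero_less_Suc mult.commute)
  qed
  thus ?thesis
    unfolding cell_def
    by (intro set_eqI) (simp only: mem_Collect_eq Int_iff atLeastAtMost_iff atLeastLessThan_iff; blast)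
qed

lemma emeasure_cell:
  "emeasure unit_measure (cell n i) = ennreal (if i \<le> n then 1 / real (Suc n) else 0)"
proof -
  have "emeasure unit_measure (cell n i) = emeasure lborel (cell n i)"
    by (rule emeasure_restrict_space) (auto simp: cell_def)
  also have "\<dots> = ennreal (if i \<le> n then 1 / real (Suc n) else 0)"
  proof (cases "i \<le> n")
    case True
    hence "real (Suc i) / real (Suc n) \<le> 1" by simp
    moreover have "0 \<le> real i / real (Suc n)" by simp
    ultimately have "cell n i = {real i / real (Suc n)..<real (Suc i) / real (Suc n)}"
      unfolding cell_eq
      by (intro set_eqI) (unfold Int_iff atLeastAtMost_iff atLeastLessThan_iff, linarith)
    moreover have "real (Suc i) / real (Suc n) - real i / real (Suc n) = 1 / real (Suc n)"
      by (simp add: diff_divide_distrib[symmetric])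
    ultimately show ?thesis using True by (simp add: divide_right_mono)
  next
    case False
    \<comment> \<open>Such a cell contains at most the endpoint 1 and is a null set.\<close>
    hence "1 \<le> real i / real (Suc n)" by (simp add: field_simps)
    hence "t = 1" if "t \<in> cell n i" for t
      using that unfolding cell_eq Int_iff atLeastAtMost_iff atLeastLessThan_iff by linarith
    hence "cell n i \<subseteq> {1}" by blast
    hence "emeasure lborel (cell n i) \<le> emeasure lborel {1::real}" by (rule emeasure_mono) auto
    thus ?thesis using False by simp
  qed
  finally show ?thesis .
qed

lemma cell_sets: "cell n i \<in> sets unit_measure"
  unfolding sets_restrict_space cell_eq by auto

interpretation unit_cube_measure: product_sigma_finite "\<lambda>_::nat. unit_measure"
  by (intro product_sigma_finite.intro sigma_finite_measure_restrict_space sigma_finite_lborel) auto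

abbreviation cube_measure :: "nat \<Rightarrow> (nat \<Rightarrow> real) measure" where
  "cube_measure s \<equiv> Pi\<^sub>M {1..s} (\<lambda>_. unit_measure)"

lemma space_cube_measure: "space (cube_measure s) = unit_cube s"
  by (simp add: space_PiM unit_cube_def space_restrict_space)

definition box :: "nat \<Rightarrow> nat \<Rightarrow> (nat \<Rightarrow> nat) \<Rightarrow> (nat \<Rightarrow> real) set" where
  "box s n k = (\<Pi>\<^sub>E j\<in>{1..s}. cell n (k j))"

lemma box_sets [measurable]: "box s n k \<in> sets (cube_measure s)"
  unfolding box_def by (intro sets_PiM_I_finite cell_sets) auto

lemma emeasure_box:
  "emeasure (cube_measure s) (box s n k) =
     ennreal (if \<forall>j\<in>{1..s}. k j \<le> n then (1 / real (Suc n)) ^ s else 0)"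
proof -
  have "emeasure (cube_measure s) (box s n k) = (\<Prod>j\<in>{1..s}. emeasure unit_measure (cell n (k j)))"
    unfolding box_def by (intro unit_cube_measure.emeasure_PiM cell_sets) auto
  also have "\<dots> = ennreal (\<Prod>j\<in>{1..s}. if k j \<le> n then 1 / real (Suc n) else 0)"
    unfolding emeasure_cell by (rule prod_ennreal) simp
  also have "(\<Prod>j\<in>{1..s}. if k j \<le> n then 1 / real (Suc n) else 0) =
      (if \<forall>j\<in>{1..s}. k j \<le> n then (1 / real (Suc n)) ^ s else 0)"
  proof (cases "\<forall>j\<in>{1..s}. k j \<le> n")
    case True
    hence "(\<Prod>j\<in>{1..s}. if k j \<le> n then 1 / real (Suc n) else 0) = (\<Prod>j\<in>{1..s}. 1 / real (Suc n))"
      by (intro prod.cong) auto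
    thus ?thesis using True by simp
  next
    case False
    hence "(\<Prod>j\<in>{1..s}. if k j \<le> n then 1 / real (Suc n) else 0) = 0"
      by (intro prod_zero) auto
    thus ?thesis using False by (simp only: if_False)
  qed
  finally show ?thesis .
qed

lemma floor_index_le:
  assumes "x \<in> unit_cube s" "j \<in> {1..s}"
  shows "nat \<lfloor>real (Suc n) * x j\<rfloor> \<le> Suc n"
proof -
  have "real (Suc n) * x j \<le> real (Suc n) * 1"
    using assms unfolding unit_cube_def by (intro mult_left_mono) auto
  hence "\<lfloor>real (Suc n) * x j\<rfloor> \<le> \<lfloor>real (Suc n)\<rfloor>" by (intro floor_mono) simp
  thus ?thesis by (simp only: floor_of_nat nat_le_iff)
qed

definition round_down :: "nat \<Rightarrow> nat \<Rightarrow> (nat \<Rightarrow> real) \<Rightarrow> nat \<Rightarrow> real" where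
  "round_down s n x = grid_point s n (\<lambda>j\<in>{1..s}. nat \<lfloor>real (Suc n) * x j\<rfloor>)"

lemma round_down_in_cube: "x \<in> unit_cube s \<Longrightarrow> round_down s n x \<in> unit_cube s"
  unfolding round_down_def
  by (rule grid_point_in_cube) (use floor_index_le in \<open>simp del: of_nat_Suc\<close>)

text \<open>
  The indices run up to \<open>Suc n\<close>, not \<open>n\<close>, so that the boxes cover the closed cube: a coordinate
  equal to \<open>1\<close> has index \<open>Suc n\<close>, and the boxes with such an index are null sets.
\<close>

definition step_function :: "nat \<Rightarrow> nat \<Rightarrow> ((nat \<Rightarrow> real) \<Rightarrow> complex) \<Rightarrow> (nat \<Rightarrow> real) \<Rightarrow> complex" where
  "step_function s n f x =
     (\<Sum>k\<in>{1..s} \<rightarrow>\<^sub>E {..Suc n}. indicator (box s n k) x *\<^sub>R f (grid_point s n k))"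

text \<open>The boxes partition the cube, and the one containing \<open>x\<close> is indexed by the
  vector of rounding indices, so a single summand survives.\<close>

lemma step_function_eq:
  assumes "x \<in> unit_cube s"
  shows "step_function s n f x = f (round_down s n x)"
proof -
  define \<kappa> where "\<kappa> = (\<lambda>j\<in>{1..s}. nat \<lfloor>real (Suc n) * x j\<rfloor>)"
  have x: "0 \<le> x j" "x j \<le> 1" if "j \<in> {1..s}" for j
    using assms that unfolding unit_cube_def by auto
  have \<kappa>: "\<kappa> \<in> {1..s} \<rightarrow>\<^sub>E {..Suc n}"
    unfolding \<kappa>_def using floor_index_le[OF assms] by (simp only: restrict_PiE_iff atMost_iff) blast
  have box: "x \<in> box s n k \<longleftrightarrow> \<kappa> = k" if "k \<in> {1..s} \<rightarrow>\<^sub>E {..Suc n}" for k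
  proof
    assume "x \<in> box s n k"
    hence "nat \<lfloor>real (Suc n) * x j\<rfloor> = k j" if "j \<in> {1..s}" for j
      using that unfolding box_def cell_def by auto
    thus "\<kappa> = k" using that unfolding \<kappa>_def
      by (intro ext) (auto simp: PiE_def extensional_def restrict_def)
  next
    assume "\<kappa> = k"
    hence "k j = nat \<lfloor>real (Suc n) * x j\<rfloor>" if "j \<in> {1..s}" for j
      using that by (auto simp: \<kappa>_def)
    thus "x \<in> box s n k"
      using x assms unfolding box_def cell_def unit_cube_def by (auto simp: PiE_iff)
  qed
  have "step_function s n f x = (\<Sum>k\<in>{1..s} \<rightarrow>\<^sub>E {..Suc n}. if \<kappa> = k then f (grid_point s n k) else 0)"
    unfolding step_function_def by (intro sum.cong) (auto simp: box indicator_def)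
  also have "\<dots> = f (grid_point s n \<kappa>)"
    using \<kappa> by (simp add: finite_PiE)
  finally show ?thesis by (simp add: \<kappa>_def round_down_def)
qed

lemma step_function_measurable [measurable]:
  "step_function s n f \<in> borel_measurable (cube_measure s)"
  unfolding step_function_def by measurable

text \<open>Boxes with an index \<open>Suc n\<close> have measure zero; the others are indexed by
  \<open>grid s n\<close> and all have the same volume, so the integral is an equally weighted
  mean.\<close>

lemma integral_step_function:
  "integral\<^sup>L (cube_measure s) (step_function s n f) =
     (\<Sum>k\<in>grid s n. f (grid_point s n k)) / of_nat (card (grid s n))"
proof -
  let ?P = "{1..s} \<rightarrow>\<^sub>E {..Suc n}"
  have meas: "measure (cube_measure s) (box s n k) =
      (if \<forall>j\<in>{1..s}. k j \<le> n then (1 / real (Suc n)) ^ s else 0)" for k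
    unfolding measure_def emeasure_box by simp
  have integrable: "integrable (cube_measure s) (indicator (box s n k) :: _ \<Rightarrow> real)" for k
    by (intro integrable_real_indicator box_sets)
       (unfold emeasure_box infinity_ennreal_def, rule ennreal_less_top)
  have "integral\<^sup>L (cube_measure s) (step_function s n f) =
        (\<Sum>k\<in>?P. measure (cube_measure s) (box s n k) *\<^sub>R f (grid_point s n k))"
    unfolding step_function_def
    using integrable
    by (subst Bochner_Integration.integral_sum) (simp_all add: sets.Int_space_eq2[OF box_sets] del: One_nat_def)
  also have "\<dots> = (\<Sum>k\<in>grid s n. f (grid_point s n k) / of_nat (card (grid s n)))"
  proof (rule sum.mono_neutral_cong_right)
    show "grid s n \<subseteq> ?P" unfolding grid_def by (intro PiE_mono) auto
    show "\<forall>k\<in>?P - grid s n. measure (cube_measure s) (box s n k) *\<^sub>R f (grid_point s n k) = 0"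
      unfolding meas grid_def by (auto simp: PiE_iff less_Suc_eq_le)
    fix k assume "k \<in> grid s n"
    hence "\<forall>j\<in>{1..s}. k j \<le> n" unfolding grid_def by (auto simp: PiE_iff less_Suc_eq_le)
    thus "measure (cube_measure s) (box s n k) *\<^sub>R f (grid_point s n k) =
        f (grid_point s n k) / of_nat (card (grid s n))"
      unfolding meas card_grid by (simp add: scaleR_conv_of_real power_divide field_simps)
  qed (auto intro: finite_PiE)
  finally show ?thesis by (simp add: sum_divide_distrib)
qed

lemma round_down_tendsto:
  assumes "x \<in> unit_cube s" "j \<in> {1..s}"
  shows "(\<lambda>n. round_down s n x j) \<longlonglongrightarrow> x j"
proof (rule tendsto_sandwich)
  have x: "0 \<le> x j" using assms unfolding unit_cube_def by auto
  have eq: "round_down s n x j =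
        real_of_int \<lfloor>real (Suc n) * x j\<rfloor> / real (Suc n)" for n
    using assms x by (simp add: round_down_def grid_point_def)
  show "eventually (\<lambda>n. x j - 1 / real (Suc n) \<le> round_down s n x j) sequentially"
  proof (rule always_eventually, rule allI)
    fix n
    have "real (Suc n) * x j - 1 \<le> real_of_int \<lfloor>real (Suc n) * x j\<rfloor>" by linarith
    hence "(real (Suc n) * x j - 1) / real (Suc n) \<le> real_of_int \<lfloor>real (Suc n) * x j\<rfloor> / real (Suc n)"
      by (rule divide_right_mono) simp
    thus "x j - 1 / real (Suc n) \<le> round_down s n x j"
      unfolding eq by (simp add: diff_divide_distrib)
  qed
  show "eventually (\<lambda>n. round_down s n x j \<le> x j) sequentially"
  proof (rule always_eventually, rule allI)
    fix n
    have "real_of_int \<lfloor>real (Suc n) * x j\<rfloor> / real (Suc n) \<le> real (Suc n) * x j / real (Suc n)"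
      by (intro divide_right_mono) auto
    thus "round_down s n x j \<le> x j"
      unfolding eq by simp
  qed
  show "(\<lambda>n. x j - 1 / real (Suc n)) \<longlonglongrightarrow> x j"
    using tendsto_diff[OF tendsto_const LIMSEQ_Suc[OF lim_1_over_n], of "x j"] by simp
qed simp

section \<open>The Korobov space: Riemann sums, the constant function and the worst-case
  error\<close>

locale korobov_space = reproducing_kernel_hilbert_space "unit_cube s" "korobov_kernel \<alpha> \<gamma> s" V ip
  for \<alpha> \<gamma> s V ip +
  assumes \<alpha>: "\<alpha> > 1"
begin

text \<open>The rounded points converge to \<open>x\<close>, the kernel is continuous along them,
  and \<open>eval_diff_le\<close> carries this over to \<open>f\<close>.\<close>

lemma step_function_tendsto:
  assumes "f \<in> V" "x \<in> unit_cube s"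
  shows "(\<lambda>n. step_function s n f x) \<longlonglongrightarrow> f x"
proof -
  define a where "a n = round_down s n x" for n
  let ?K = "korobov_kernel \<alpha> \<gamma> s"
  have a_cube: "a n \<in> unit_cube s" for n
    unfolding a_def using assms(2) by (rule round_down_in_cube)
  have char: "(\<lambda>n. fourier_char u h (a n)) \<longlonglongrightarrow> fourier_char u h x" if "u \<subseteq> {1..s}" for u h
    unfolding fourier_char_def a_def using that assms
    by (intro tendsto_intros round_down_tendsto) auto
  have K: "(\<lambda>n. ?K (a n) x) \<longlonglongrightarrow> ?K x x" "(\<lambda>n. ?K x (a n)) \<longlonglongrightarrow> ?K x x"
          "(\<lambda>n. ?K (a n) (a n)) \<longlonglongrightarrow> ?K x x"
    unfolding korobov_kernel_eq
    by (intro korobov_series_tendsto[OF \<alpha>] tendsto_mult tendsto_cnj char tendsto_const;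
        simp add: norm_mult)+
  have "(\<lambda>n. hnorm ip f * sqrt (Re (?K (a n) (a n) - ?K (a n) x - ?K x (a n) + ?K x x)))
          \<longlonglongrightarrow> hnorm ip f * sqrt (Re (?K x x - ?K x x - ?K x x + ?K x x))"
    by (intro tendsto_intros K)
  hence "(\<lambda>n. f (a n) - f x) \<longlonglongrightarrow> 0"
    using Lim_null_comparison[OF always_eventually[OF allI[OF eval_diff_le[OF assms(1) a_cube assms(2)]]]]
    by simp
  thus ?thesis
    unfolding step_function_eq[OF assms(2)] a_def[symmetric] by (simp add: LIM_zero_iff)
qed

lemma grid_mean_tendsto_integral:
  assumes "f \<in> V"
  shows "(\<lambda>n. (\<Sum>k\<in>grid s n. f (grid_point s n k)) / of_nat (card (grid s n))) \<longlonglongrightarrow> cube_integral s f"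
proof -
  \<comment> \<open>On the diagonal every character cancels against its conjugate, so the kernel is
    constant there and yields a bound independent of \<open>x\<close>.\<close>
  let ?B = "hnorm ip f * sqrt (Re (korobov_series \<alpha> \<gamma> s (\<lambda>_ _. 1)))"
  have bound: "cmod (f x) \<le> ?B" if "x \<in> unit_cube s" for x
    using eval_le[OF assms that] unfolding korobov_kernel_eq by simp
  have fin: "emeasure (cube_measure s) (space (cube_measure s)) < \<infinity>"
  proof -
    have "emeasure (cube_measure s) (unit_cube s) = (\<Prod>j\<in>{1..s}. emeasure unit_measure {0..1})"
      unfolding unit_cube_def by (intro unit_cube_measure.emeasure_PiM) (auto simp: sets_restrict_space)
    also have "\<dots> = 1" by (simp add: emeasure_restrict_space)
    finally show ?thesis
      unfolding space_cube_measure by (simp only: ennreal_one_less_top infinity_ennreal_def)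
  qed
  have "(\<lambda>n. integral\<^sup>L (cube_measure s) (step_function s n f)) \<longlonglongrightarrow> integral\<^sup>L (cube_measure s) f"
  proof (rule integral_dominated_convergence)
    \<comment> \<open>Measurability is not part of membership in \<open>V\<close>; it follows since
      \<open>f\<close> is a pointwise limit of step functions.\<close>
    show "f \<in> borel_measurable (cube_measure s)"
      by (rule borel_measurable_LIMSEQ_metric[OF step_function_measurable step_function_tendsto[OF assms]])
         (simp only: space_cube_measure)
    show "integrable (cube_measure s) (\<lambda>_. ?B)"
      by (rule finite_measure.integrable_const[OF finite_measureI]) (use fin in simp)
    show "AE x in cube_measure s. (\<lambda>n. step_function s n f x) \<longlonglongrightarrow> f x"
      using step_function_tendsto[OF assms] by (intro AE_I2) (simp only: space_cube_measure)
    show "AE x in cube_measure s. cmod (step_function s n f x) \<le> ?B" for n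
    proof (rule AE_I2)
      fix x assume "x \<in> space (cube_measure s)"
      hence x: "x \<in> unit_cube s" unfolding space_cube_measure .
      thus "cmod (step_function s n f x) \<le> ?B"
        unfolding step_function_eq[OF x] by (intro bound round_down_in_cube)
    qed
  qed (rule step_function_measurable)
  thus ?thesis unfolding integral_step_function cube_integral_def .
qed

text \<open>The representer of the equally weighted quadrature rule on the grid, as
  \<open>ip_grid_mean\<close> shows.\<close>

definition grid_mean :: "nat \<Rightarrow> (nat \<Rightarrow> real) \<Rightarrow> complex" where
  "grid_mean n = (\<lambda>x.
     (\<Sum>k\<in>grid s n. kernel_section (unit_cube s) (korobov_kernel \<alpha> \<gamma> s) (grid_point s n k) x)
       / of_nat (card (grid s n)))"

text \<open>The constant function 1 on the cube, set to 0 outside since elements of \<open>V\<close>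
  vanish there.\<close>

definition one :: "(nat \<Rightarrow> real) \<Rightarrow> complex" where
  "one = (\<lambda>x. if x \<in> unit_cube s then 1 else 0)"

lemma grid_in_cube: "k \<in> grid s n \<Longrightarrow> grid_point s n k \<in> unit_cube s"
  by (rule grid_point_in_cube) (auto simp: grid_def PiE_iff less_imp_le)

lemma grid_mean_mem: "grid_mean n \<in> V"
  unfolding grid_mean_def by (intro mean_mem grid_finite kernel_mem grid_in_cube)

lemma grid_mean_eq:
  assumes "x \<in> unit_cube s"
  shows "grid_mean n x = korobov_series \<alpha> \<gamma> s (\<lambda>u h. fourier_char u h x * cnj (grid_mean_char s u h n))"
proof -
  have "grid_mean n x =
      (\<Sum>k\<in>grid s n. korobov_series \<alpha> \<gamma> s (\<lambda>u h.
          fourier_char u h x * cnj (fourier_char u h (grid_point s n k))))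
        / of_nat (card (grid s n))"
    unfolding grid_mean_def kernel_section_def korobov_kernel_eq using assms by simp
  also have "\<dots> = korobov_series \<alpha> \<gamma> s (\<lambda>u h.
      (\<Sum>k\<in>grid s n. fourier_char u h x * cnj (fourier_char u h (grid_point s n k)))
        / of_nat (card (grid s n)))"
    by (intro korobov_series_mean[OF \<alpha>] grid_finite grid_nonempty) (simp add: norm_mult)
  finally show ?thesis unfolding grid_mean_char_def by (simp add: sum_distrib_left)
qed

lemma ip_grid_mean:
  assumes "f \<in> V"
  shows "ip f (grid_mean n) = (\<Sum>k\<in>grid s n. f (grid_point s n k)) / of_nat (card (grid s n))"
  unfolding grid_mean_def using assms
  by (subst ip_mean_right)
     (auto intro!: grid_finite kernel_mem grid_in_cube simp: reproducing[symmetric] grid_in_cube)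

lemma ip_grid_mean_grid_mean:
  "ip (grid_mean m) (grid_mean n) =
     korobov_series \<alpha> \<gamma> s (\<lambda>u h. grid_mean_char s u h n * cnj (grid_mean_char s u h m))"
proof -
  have "ip (grid_mean m) (grid_mean n) =
      (\<Sum>k\<in>grid s n. grid_mean m (grid_point s n k)) / of_nat (card (grid s n))"
    by (rule ip_grid_mean[OF grid_mean_mem])
  also have "\<dots> = (\<Sum>k\<in>grid s n. korobov_series \<alpha> \<gamma> s (\<lambda>u h.
      fourier_char u h (grid_point s n k) * cnj (grid_mean_char s u h m)))
      / of_nat (card (grid s n))"
    by (intro arg_cong2[of _ _ _ _ "(/)"] sum.cong grid_mean_eq grid_in_cube refl)
  also have "\<dots> = korobov_series \<alpha> \<gamma> s (\<lambda>u h.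
      (\<Sum>k\<in>grid s n. fourier_char u h (grid_point s n k) * cnj (grid_mean_char s u h m))
        / of_nat (card (grid s n)))"
    by (intro korobov_series_mean[OF \<alpha>] grid_finite grid_nonempty)
       (simp add: norm_mult norm_grid_mean_char)
  finally show ?thesis
    by (simp only: grid_mean_char_def[of _ _ _ n] sum_distrib_right[symmetric] times_divide_eq_left)
qed

lemma korobov_series_zero: "korobov_series \<alpha> \<gamma> s (\<lambda>_ _. 0) = 1"
  by (simp add: korobov_series_def)

text \<open>Every nonzero frequency eventually drops out, which leaves the constant term. The
  product filter lets both indices grow independently, as the Cauchy property demands.\<close>

lemma ip_grid_means_tendsto:
  "((\<lambda>(m, n). ip (grid_mean m) (grid_mean n)) \<longlongrightarrow> 1) (sequentially \<times>\<^sub>F sequentially)"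
  unfolding ip_grid_mean_grid_mean case_prod_unfold korobov_series_zero[symmetric]
proof (rule korobov_series_tendsto[OF \<alpha>])
  show "cmod (grid_mean_char s u h (snd p) * cnj (grid_mean_char s u h (fst p))) \<le> 1"
    for u h and p :: "nat \<times> nat"
    unfolding norm_mult complex_mod_cnj by (intro mult_le_one norm_grid_mean_char norm_ge_zero)
next
  fix u and h :: "nat \<Rightarrow> int" assume "u \<subseteq> {1..s}" "u \<noteq> {}" "h \<in> u \<rightarrow>\<^sub>E (UNIV - {0})"
  hence "eventually (\<lambda>n. grid_mean_char s u h n = 0) sequentially"
    by (rule eventually_grid_mean_char_eq_0)
  hence "eventually (\<lambda>p. grid_mean_char s u h (fst p) = 0) (sequentially \<times>\<^sub>F sequentially)"
    by (rule eventually_compose_filterlim[OF _ filterlim_fst])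
  thus "((\<lambda>p. grid_mean_char s u h (snd p) * cnj (grid_mean_char s u h (fst p))) \<longlongrightarrow> 0)
          (sequentially \<times>\<^sub>F sequentially)"
    by (intro tendsto_eventually) (auto elim: eventually_mono)
qed (simp add: prod_filter_eq_bot)

text \<open>The squared distance of two grid means tends to \<open>1 - 1 - 1 + 1\<close>, so they
  form a Cauchy sequence. The limit provided by completeness is identified pointwise, because norm
  convergence implies pointwise convergence.\<close>

lemma grid_mean_tendsto_one: "one \<in> V" "(\<lambda>n. hnorm ip (\<lambda>x. grid_mean n x - one x)) \<longlonglongrightarrow> 0"
proof -
  let ?F = "sequentially \<times>\<^sub>F sequentially"
  let ?d = "\<lambda>p. hnorm ip (\<lambda>x. grid_mean (fst p) x - grid_mean (snd p) x)"
  \<comment> \<open>Stated for arbitrary index maps so that it covers all four inner products of the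
    expanded square.\<close>
  have lim: "((\<lambda>p. ip (grid_mean (g p)) (grid_mean (g' p))) \<longlongrightarrow> 1) ?F"
    if "filterlim g sequentially ?F" "filterlim g' sequentially ?F" for g g'
    using filterlim_compose[OF ip_grid_means_tendsto filterlim_Pair[OF that]] by simp
  have "((\<lambda>p. Re (ip (grid_mean (fst p)) (grid_mean (fst p)) - ip (grid_mean (fst p)) (grid_mean (snd p))
           - ip (grid_mean (snd p)) (grid_mean (fst p)) + ip (grid_mean (snd p)) (grid_mean (snd p))))
         \<longlongrightarrow> Re (1 - 1 - 1 + 1)) ?F"
    by (intro tendsto_intros lim filterlim_fst filterlim_snd)
  hence "((\<lambda>p. (?d p)\<^sup>2) \<longlongrightarrow> 0) ?F"
    by (simp add: hnorm_diff_sq grid_mean_mem)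
  from tendsto_real_sqrt[OF this] have d: "(?d \<longlongrightarrow> 0) ?F"
    by (simp add: hnorm_nonneg diff_mem grid_mean_mem)
  have "\<exists>M. \<forall>m\<ge>M. \<forall>n\<ge>M. hnorm ip (\<lambda>x. grid_mean m x - grid_mean n x) < \<epsilon>" if "\<epsilon> > 0" for \<epsilon>
    using order_tendstoD(2)[OF d that] unfolding eventually_prod_sequentially by auto
  from complete[OF grid_mean_mem this] obtain g where
    g: "g \<in> V" "(\<lambda>n. hnorm ip (\<lambda>x. grid_mean n x - g x)) \<longlonglongrightarrow> 0" by blast
  have "g = one"
  proof
    fix x
    show "g x = one x"
    proof (cases "x \<in> unit_cube s")
      case False
      thus ?thesis using supported[OF g(1)] by (simp add: one_def)
    next
      case True
      let ?B = "sqrt (Re (korobov_kernel \<alpha> \<gamma> s x x))"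
      have "(\<lambda>n. grid_mean n x - g x) \<longlonglongrightarrow> 0"
      proof (rule Lim_null_comparison[OF always_eventually])
        show "\<forall>n. cmod (grid_mean n x - g x) \<le> hnorm ip (\<lambda>x. grid_mean n x - g x) * ?B"
          using eval_le[OF diff_mem[OF grid_mean_mem g(1)] True] by blast
        show "(\<lambda>n. hnorm ip (\<lambda>x. grid_mean n x - g x) * ?B) \<longlonglongrightarrow> 0"
          using tendsto_mult_right[OF g(2), of ?B] by simp
      qed
      hence "(\<lambda>n. grid_mean n x) \<longlonglongrightarrow> g x" by (simp add: LIM_zero_iff)
      moreover have "(\<lambda>n. grid_mean n x) \<longlonglongrightarrow> 1"
        unfolding grid_mean_eq[OF True] korobov_series_zero[symmetric]
      proof (rule korobov_series_tendsto[OF \<alpha>])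
        fix u and h :: "nat \<Rightarrow> int" assume "u \<subseteq> {1..s}" "u \<noteq> {}" "h \<in> u \<rightarrow>\<^sub>E (UNIV - {0})"
        hence "eventually (\<lambda>n. grid_mean_char s u h n = 0) sequentially"
          by (rule eventually_grid_mean_char_eq_0)
        thus "(\<lambda>n. fourier_char u h x * cnj (grid_mean_char s u h n)) \<longlonglongrightarrow> 0"
          by (intro tendsto_eventually) (auto elim: eventually_mono)
      qed (auto simp: norm_mult norm_grid_mean_char)
      ultimately have "g x = 1" by (rule LIMSEQ_unique)
      thus ?thesis using True by (simp add: one_def)
    qed
  qed
  thus "one \<in> V" "(\<lambda>n. hnorm ip (\<lambda>x. grid_mean n x - one x)) \<longlonglongrightarrow> 0" using g by auto
qed

lemma ip_grid_mean_tendsto: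
  assumes "f \<in> V"
  shows "(\<lambda>n. ip f (grid_mean n)) \<longlonglongrightarrow> ip f one"
proof -
  have "(\<lambda>n. ip f (grid_mean n) - ip f one) \<longlonglongrightarrow> 0"
  proof (rule Lim_null_comparison[OF always_eventually])
    show "\<forall>n. cmod (ip f (grid_mean n) - ip f one) \<le> hnorm ip f * hnorm ip (\<lambda>x. grid_mean n x - one x)"
      using Cauchy_Schwarz[OF assms diff_mem[OF grid_mean_mem grid_mean_tendsto_one(1)]]
      by (simp add: ip_diff_right assms grid_mean_mem grid_mean_tendsto_one(1))
    show "(\<lambda>n. hnorm ip f * hnorm ip (\<lambda>x. grid_mean n x - one x)) \<longlonglongrightarrow> 0"
      using tendsto_mult_left[OF grid_mean_tendsto_one(2), of "hnorm ip f"] by simp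
  qed
  thus ?thesis by (simp add: LIM_zero_iff)
qed

text \<open>The inner products with \<open>grid_mean n\<close> are Riemann sums of \<open>f\<close>,
  which converge to the integral; they also converge to the inner product with
  \<open>one\<close>.\<close>

lemma cube_integral_eq_ip:
  assumes "f \<in> V"
  shows "cube_integral s f = ip f one"
proof (rule LIMSEQ_unique)
  show "(\<lambda>n. ip f (grid_mean n)) \<longlonglongrightarrow> cube_integral s f"
    unfolding ip_grid_mean[OF assms] using assms by (rule grid_mean_tendsto_integral)
qed (rule ip_grid_mean_tendsto[OF assms])

lemma ip_one_one: "ip one one = 1"
proof (rule LIMSEQ_unique[OF ip_grid_mean_tendsto])
  have "ip one (grid_mean n) = 1" for n
  proof -
    have "(\<Sum>k\<in>grid s n. one (grid_point s n k)) = (\<Sum>k\<in>grid s n. 1)"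
      by (rule sum.cong) (auto simp: one_def grid_in_cube)
    moreover have "card (grid s n) \<noteq> 0" by (simp add: card_grid)
    ultimately show ?thesis by (simp add: ip_grid_mean grid_mean_tendsto_one(1))
  qed
  thus "(\<lambda>n. ip one (grid_mean n)) \<longlonglongrightarrow> 1" by simp
qed (rule grid_mean_tendsto_one)

text \<open>The lattice rule is represented by \<open>q\<close>, so the error functional is
  represented by \<open>one - q\<close> and its supremum over the unit ball is a norm. All inner
  products involving \<open>one\<close> are 1, so the square reduces to \<open>ip q q - 1\<close>,
  and orthogonality of characters on the lattice turns \<open>ip q q\<close> into sums over the dual
  sets.\<close>

lemma
  assumes "N > 0"
  shows worst_case_error_nonneg: "0 \<le> worst_case_error V ip N s \<xi>"
    and worst_case_error_sq:
      "(worst_case_error V ip N s \<xi>)\<^sup>2 = (\<Sum>u\<in>Pow {1..s} - {{}}. \<gamma> u * dual_sum \<alpha> N u \<xi>)"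
proof -
  let ?p = "lattice_point N s \<xi>"
  let ?k = "\<lambda>n. kernel_section (unit_cube s) (korobov_kernel \<alpha> \<gamma> s) (?p n)"
  let ?M = "\<lambda>u h. (\<Sum>n<N. fourier_char u h (?p n)) / of_nat N"
  define q where "q = (\<lambda>x. (\<Sum>n<N. ?k n x) / of_nat N)"
  have k: "?k n \<in> V" for n by (intro kernel_mem lattice_point_in_cube)
  have q: "q \<in> V" unfolding q_def by (intro mean_mem k) simp
  have ip_q: "ip f q = (\<Sum>n<N. f (?p n)) / of_nat N" if "f \<in> V" for f
    unfolding q_def using that k
    by (subst ip_mean_right) (auto simp: reproducing[symmetric] lattice_point_in_cube)
  note one = grid_mean_tendsto_one(1)
  have "worst_case_error V ip N s \<xi> = hnorm ip (\<lambda>x. one x - q x)"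
    unfolding worst_case_error_def
  proof (rule SUP_unit_ball)
    show "(\<lambda>x. one x - q x) \<in> V" using one q diff_mem by blast
    fix f assume "f \<in> V"
    thus "cube_integral s f - 1 / of_nat N * (\<Sum>n<N. f (?p n)) = ip f (\<lambda>x. one x - q x)"
      using one q by (simp add: ip_diff_right ip_q cube_integral_eq_ip)
  qed
  note error = this
  thus "0 \<le> worst_case_error V ip N s \<xi>" using one q by (simp add: hnorm_nonneg diff_mem)
  have "(worst_case_error V ip N s \<xi>)\<^sup>2 = Re (ip one one - ip one q - ip q one + ip q q)"
    unfolding error using one q by (simp add: hnorm_diff_sq)
  \<comment> \<open>The lattice rule is exact for the constant function.\<close>
  moreover have one_q: "ip one q = 1"
    using assms by (simp add: ip_q one) (simp add: one_def lattice_point_in_cube)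
  moreover have "ip q one = 1" using ip_cnj[OF one q] one_q by simp
  ultimately have "(worst_case_error V ip N s \<xi>)\<^sup>2 = Re (ip q q) - 1"
    by (simp add: ip_one_one)
  also have "ip q q = korobov_series \<alpha> \<gamma> s (\<lambda>u h.
      (\<Sum>n<N. fourier_char u h (?p n) * cnj (?M u h)) / of_nat N)"
  proof -
    have q_eq: "q x = korobov_series \<alpha> \<gamma> s (\<lambda>u h.
        fourier_char u h x * cnj (?M u h))"
      if "x \<in> unit_cube s" for x
    proof -
      have "q x = (\<Sum>n<N. korobov_series \<alpha> \<gamma> s (\<lambda>u h. fourier_char u h x * cnj (fourier_char u h (?p n))))
          / of_nat (card {..<N})"
        unfolding q_def kernel_section_def korobov_kernel_eq using that by simp
      also have "\<dots> = korobov_series \<alpha> \<gamma> s (\<lambda>u h.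
          (\<Sum>n<N. fourier_char u h x * cnj (fourier_char u h (?p n))) / of_nat (card {..<N}))"
        using assms by (intro korobov_series_mean[OF \<alpha>]) (auto simp: norm_mult)
      finally show ?thesis by (simp add: sum_distrib_left)
    qed
    have le: "cmod (fourier_char u h x * cnj (?M u h)) \<le> 1" for u h x
      unfolding norm_mult complex_mod_cnj
      using norm_mean_le[of "{..<N}" "\<lambda>n. fourier_char u h (?p n)"] by simp
    have "ip q q = (\<Sum>n<N. q (?p n)) / of_nat (card {..<N})" by (simp add: ip_q[OF q])
    also have "\<dots> = (\<Sum>n<N. korobov_series \<alpha> \<gamma> s (\<lambda>u h.
        fourier_char u h (?p n) * cnj (?M u h))) / of_nat (card {..<N})"
      by (simp only: q_eq lattice_point_in_cube)
    also have "\<dots> = korobov_series \<alpha> \<gamma> s (\<lambda>u h. (\<Sum>n<N.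
        fourier_char u h (?p n) * cnj (?M u h)) / of_nat (card {..<N}))"
      by (intro korobov_series_mean[OF \<alpha>] le) (use assms in auto)
    finally show ?thesis by simp
  qed
  also have "\<dots> = 1 + (\<Sum>u\<in>Pow {1..s} - {{}}. complex_of_real (\<gamma> u * dual_sum \<alpha> N u \<xi>))"
    unfolding korobov_series_def
  proof (intro arg_cong2[of _ _ _ _ "(+)"] refl sum.cong)
    fix u assume "u \<in> Pow {1..s} - {{}}"
    hence u: "u \<subseteq> {1..s}" by auto
    hence fin: "finite u" using finite_subset by blast
    let ?D = "{h \<in> u \<rightarrow>\<^sub>E (UNIV - {0}). int N dvd (\<Sum>j\<in>u. h j * \<xi> j)}"
    have "(\<Sum>\<^sub>\<infinity>h\<in>u \<rightarrow>\<^sub>E (UNIV - {0}). (\<Sum>n<N. fourier_char u h (?p n) * cnj (?M u h)) / of_nat N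
             * complex_of_real (freq_weight \<alpha> u h)) =
          (\<Sum>\<^sub>\<infinity>h\<in>?D. complex_of_real (freq_weight \<alpha> u h))"
    proof (rule infsum_cong_neutral)
      \<comment> \<open>\<open>?M u h\<close> is 0 or 1 by \<open>fourier_char_lattice_mean\<close>,
        so its product with its conjugate is the same indicator of the dual set.\<close>
      have mean: "(\<Sum>n<N. fourier_char u h (?p n) * cnj (?M u h)) / of_nat N =
            (if int N dvd (\<Sum>j\<in>u. h j * \<xi> j) then 1 else 0)" for h
        unfolding sum_distrib_right[symmetric] times_divide_eq_left[symmetric]
          fourier_char_lattice_mean[OF u assms] by simp
      show "\<And>h. h \<in> (u \<rightarrow>\<^sub>E (UNIV - {0})) - ?D \<Longrightarrow>
           (\<Sum>n<N. fourier_char u h (?p n) * cnj (?M u h)) / of_nat N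
             * complex_of_real (freq_weight \<alpha> u h) = 0"
        "\<And>h. h \<in> (u \<rightarrow>\<^sub>E (UNIV - {0})) \<inter> ?D \<Longrightarrow>
           (\<Sum>n<N. fourier_char u h (?p n) * cnj (?M u h)) / of_nat N
             * complex_of_real (freq_weight \<alpha> u h) = complex_of_real (freq_weight \<alpha> u h)"
        unfolding mean by auto
    qed auto
    also have "\<dots> = complex_of_real (dual_sum \<alpha> N u \<xi>)"
      unfolding dual_sum_def
      by (intro infsumI has_sum_of_real has_sum_infsum freq_weight_summable \<alpha> fin) auto
    finally show "complex_of_real (\<gamma> u) * (\<Sum>\<^sub>\<infinity>h\<in>u \<rightarrow>\<^sub>E (UNIV - {0}).
       (\<Sum>n<N. fourier_char u h (?p n) * cnj (?M u h)) / of_nat N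
             * complex_of_real (freq_weight \<alpha> u h)) = complex_of_real (\<gamma> u * dual_sum \<alpha> N u \<xi>)"
      by simp
  qed
  finally show "(worst_case_error V ip N s \<xi>)\<^sup>2 = (\<Sum>u\<in>Pow {1..s} - {{}}. \<gamma> u * dual_sum \<alpha> N u \<xi>)"
    by (simp add: Re_sum)
qed

end

subsection \<open>The successive coordinate search\<close>

text \<open>After division by \<open>t = x + y\<close> the two fractions lie in the unit interval
  and sum to 1, and raising such a fraction to a power at most 1 does not decrease it.\<close>

lemma powr_add_le:
  fixes x y \<theta> :: real
  assumes "0 \<le> x" "0 \<le> y" "0 < \<theta>" "\<theta> \<le> 1"
  shows "(x + y) powr \<theta> \<le> x powr \<theta> + y powr \<theta>"
proof (cases "x + y = 0")
  case True
  thus ?thesis by simp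
next
  case False
  define t where "t = x + y"
  have t: "t > 0" using False assms by (simp add: t_def)
  have le: "t powr \<theta> * (z / t) \<le> z powr \<theta>" if "0 \<le> z" "z \<le> t" for z
  proof (cases "z = 0")
    case False
    have "(z / t) powr 1 \<le> (z / t) powr \<theta>"
      using that t assms False by (intro powr_mono') auto
    hence "t powr \<theta> * (z / t) \<le> t powr \<theta> * (z / t) powr \<theta>"
      using that t by (intro mult_left_mono) auto
    also have "\<dots> = z powr \<theta>"
      using that t by (simp add: powr_divide)
    finally show ?thesis .
  qed simp
  have "t powr \<theta> = t powr \<theta> * (x / t) + t powr \<theta> * (y / t)"
    using t by (simp add: t_def add_divide_distrib[symmetric] distrib_left[symmetric])
  also have "\<dots> \<le> x powr \<theta> + y powr \<theta>"
    using assms by (intro add_mono le) (auto simp: t_def)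
  finally show ?thesis by (simp add: t_def)
qed

lemma powr_sum_le:
  fixes f :: "'i \<Rightarrow> real"
  assumes "\<And>i. i \<in> I \<Longrightarrow> 0 \<le> f i" "0 < \<theta>" "\<theta> \<le> 1"
  shows "(\<Sum>i\<in>I. f i) powr \<theta> \<le> (\<Sum>i\<in>I. f i powr \<theta>)"
  using assms(1)
proof (induction I rule: infinite_finite_induct)
  case (insert i I)
  have "(f i + (\<Sum>i\<in>I. f i)) powr \<theta> \<le> f i powr \<theta> + (\<Sum>i\<in>I. f i) powr \<theta>"
    using insert assms by (intro powr_add_le sum_nonneg) auto
  also have "\<dots> \<le> f i powr \<theta> + (\<Sum>i\<in>I. f i powr \<theta>)"
    using insert by simp
  finally show ?case using insert by simp
qed auto

lemma le_powr_inverse_iff: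
  fixes x y \<theta> :: real
  assumes "0 \<le> x" "0 \<le> y" "0 < \<theta>"
  shows "x \<le> y powr (1 / \<theta>) \<longleftrightarrow> x powr \<theta> \<le> y"
proof
  assume "x \<le> y powr (1 / \<theta>)"
  hence "x powr \<theta> \<le> (y powr (1 / \<theta>)) powr \<theta>" using assms by (intro powr_mono2) auto
  thus "x powr \<theta> \<le> y" using assms by (simp add: powr_powr)
next
  assume "x powr \<theta> \<le> y"
  hence "(x powr \<theta>) powr (1 / \<theta>) \<le> y powr (1 / \<theta>)" using assms by (intro powr_mono2) auto
  thus "x \<le> y powr (1 / \<theta>)" using assms by (simp add: powr_powr)
qed

lemma freq_weight_powr: "freq_weight \<alpha> u h powr \<theta> = freq_weight (\<alpha> * \<theta>) u h"
  unfolding freq_weight_def by (subst prod_powr_distrib) (auto simp: powr_powr)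

lemma dual_sum_powr_le:
  assumes "1 < \<alpha> * \<theta>" "0 < \<theta>" "\<theta> \<le> 1" "finite u"
  shows "dual_sum \<alpha> N u \<xi> powr \<theta> \<le> dual_sum (\<alpha> * \<theta>) N u \<xi>"
proof -
  let ?D = "{h \<in> u \<rightarrow>\<^sub>E (UNIV - {0}). int N dvd (\<Sum>j\<in>u. h j * \<xi> j)}"
  have "0 < \<alpha>" using assms by (metis less_trans zero_less_mult_pos2 zero_less_one)
  hence "\<alpha> * \<theta> \<le> \<alpha>" using assms by (simp add: mult_left_le)
  hence \<alpha>: "\<alpha> > 1" using assms by simp
  \<comment> \<open>With the exponent moved to the right, the left side is a plain infinite sum and
    can be bounded through its finite partial sums, to which \<open>powr_sum_le\<close>
    applies.\<close>
  have "dual_sum \<alpha> N u \<xi> \<le> dual_sum (\<alpha> * \<theta>) N u \<xi> powr (1 / \<theta>)"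
    unfolding dual_sum_def[of \<alpha>]
  proof (rule infsum_le_finite_sums)
    show "freq_weight \<alpha> u summable_on ?D"
      by (rule freq_weight_summable[OF \<alpha> assms(4)]) auto
    fix F assume F: "finite F" "F \<subseteq> ?D"
    have "(\<Sum>h\<in>F. freq_weight \<alpha> u h) powr \<theta> \<le> (\<Sum>h\<in>F. freq_weight (\<alpha> * \<theta>) u h)"
      using powr_sum_le[of F "freq_weight \<alpha> u" \<theta>] assms
      by (simp add: freq_weight_powr freq_weight_nonneg)
    also have "\<dots> \<le> dual_sum (\<alpha> * \<theta>) N u \<xi>"
      unfolding dual_sum_def
      by (rule finite_sum_le_infsum[OF freq_weight_summable])
         (use assms F freq_weight_nonneg in auto)
    finally show "(\<Sum>h\<in>F. freq_weight \<alpha> u h) \<le> dual_sum (\<alpha> * \<theta>) N u \<xi> powr (1 / \<theta>)"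
      using assms
      by (subst le_powr_inverse_iff) (auto intro: sum_nonneg freq_weight_nonneg dual_sum_nonneg)
  qed
  thus ?thesis using assms by (subst (asm) le_powr_inverse_iff) (auto simp: dual_sum_nonneg)
qed

lemma minimum_le_mean:
  fixes f :: "'a \<Rightarrow> real"
  assumes "finite A" "A \<noteq> {}" "\<And>y. y \<in> A \<Longrightarrow> m \<le> f y"
  shows "m \<le> (\<Sum>y\<in>A. f y) / real (card A)"
  using sum_bounded_below[of A m f] assms by (simp add: pos_le_divide_eq card_gt_0_iff mult.commute)

text \<open>Induction on the number of completed steps: the objective of step \<open>d\<close> only
  reads components of \<open>z\<close> below \<open>d\<close>, so choosing the next component keeps
  the earlier minimality.\<close>

lemma scs_output_exists:
  assumes "unit_residues N \<noteq> {}"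
  shows "\<exists>z. scs_output V ip N s z0 z"
proof -
  let ?e = "\<lambda>z d y. (worst_case_error V ip N s (\<lambda>j. if j < d then z j else if j = d then y else z0 j))\<^sup>2"
  have "\<exists>z. \<forall>d\<in>{1..n}. is_arg_min (?e z d) (\<lambda>y. y \<in> unit_residues N) (z d)" for n
  proof (induction n)
    case (Suc n)
    then obtain z where z: "\<forall>d\<in>{1..n}. is_arg_min (?e z d) (\<lambda>y. y \<in> unit_residues N) (z d)" by blast
    obtain y where y: "is_arg_min (?e z (Suc n)) (\<lambda>y. y \<in> unit_residues N) y"
      using ex_is_arg_min_if_finite[OF finite_unit_residues assms] by blast
    let ?z = "z(Suc n := y)"
    have same: "?e ?z d = ?e z d" if "d \<le> Suc n" for d
    proof -
      have "(\<lambda>j. if j < d then ?z j else if j = d then y' else z0 j) =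
            (\<lambda>j. if j < d then z j else if j = d then y' else z0 j)" for y'
        using that by auto
      thus ?thesis by simp
    qed
    have "is_arg_min (?e ?z d) (\<lambda>y. y \<in> unit_residues N) (?z d)" if "d \<in> {1..Suc n}" for d
    proof -
      have "d \<le> Suc n" using that by simp
      thus ?thesis unfolding same[OF \<open>d \<le> Suc n\<close>] using z y that by (cases "d = Suc n") auto
    qed
    thus ?case by blast
  qed simp
  thus ?thesis unfolding scs_output_def by blast
qed

context korobov_space
begin

text \<open>This is \<open>T d\<close> when \<xi> is the vector held right after step
  \<open>d\<close>.\<close>

definition step_error :: "nat \<Rightarrow> nat \<Rightarrow> (nat \<Rightarrow> int) \<Rightarrow> real" where
  "step_error N d \<xi> = (\<Sum>u\<in>{u \<in> Pow {1..s}. d \<in> u}. \<gamma> u * dual_sum \<alpha> N u \<xi>)"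

context
  fixes N :: nat
  assumes N: "N > 0" "unit_residues N \<noteq> {}"
    and \<gamma>: "\<And>u. u \<subseteq> {1..s} \<Longrightarrow> u \<noteq> {} \<Longrightarrow> 0 \<le> \<gamma> u"
begin

text \<open>Sets without \<open>d\<close> contribute the same amount for every choice, so minimising
  the whole error minimises this part.\<close>

lemma step_error_minimal:
  assumes "is_arg_min (\<lambda>y. (worst_case_error V ip N s (\<xi>(d := y)))\<^sup>2) (\<lambda>y. y \<in> unit_residues N) z"
    and "y \<in> unit_residues N"
  shows "step_error N d (\<xi>(d := z)) \<le> step_error N d (\<xi>(d := y))"
proof -
  let ?R = "{u \<in> Pow {1..s} - {{}}. d \<notin> u}"
  have split: "(worst_case_error V ip N s (\<xi>(d := y)))\<^sup>2 =
      step_error N d (\<xi>(d := y)) + (\<Sum>u\<in>?R. \<gamma> u * dual_sum \<alpha> N u \<xi>)" for y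
  proof -
    have "(\<Sum>u\<in>?R. \<gamma> u * dual_sum \<alpha> N u (\<xi>(d := y))) = (\<Sum>u\<in>?R. \<gamma> u * dual_sum \<alpha> N u \<xi>)"
      by (intro sum.cong refl arg_cong2[of _ _ _ _ "(*)"] dual_sum_cong) auto
    moreover have "(worst_case_error V ip N s (\<xi>(d := y)))\<^sup>2 =
        (\<Sum>u\<in>{u \<in> Pow {1..s}. d \<in> u} \<union> ?R. \<gamma> u * dual_sum \<alpha> N u (\<xi>(d := y)))"
      unfolding worst_case_error_sq[OF N(1)] by (rule sum.cong) auto
    moreover have "(\<Sum>u\<in>{u \<in> Pow {1..s}. d \<in> u} \<union> ?R. \<gamma> u * dual_sum \<alpha> N u (\<xi>(d := y))) =
        step_error N d (\<xi>(d := y)) + (\<Sum>u\<in>?R. \<gamma> u * dual_sum \<alpha> N u (\<xi>(d := y)))"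
      unfolding step_error_def by (rule sum.union_disjoint) auto
    ultimately show ?thesis by (simp only:)
  qed
  have "(worst_case_error V ip N s (\<xi>(d := z)))\<^sup>2 \<le> (worst_case_error V ip N s (\<xi>(d := y)))\<^sup>2"
    using assms unfolding is_arg_min_linorder by blast
  thus ?thesis unfolding split by simp
qed

lemma step_error_powr_le:
  assumes "\<And>y. y \<in> unit_residues N \<Longrightarrow> step_error N d (\<xi>(d := z)) \<le> step_error N d (\<xi>(d := y))"
    and "1 < \<alpha> * \<theta>" "0 < \<theta>" "\<theta> \<le> 1"
  shows "step_error N d (\<xi>(d := z)) powr \<theta> \<le>
    (\<Sum>u\<in>{u \<in> Pow {1..s}. d \<in> u}. \<gamma> u powr \<theta> * (2 * zeta (\<alpha> * \<theta>)) ^ card u)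
      / real (card (unit_residues N))"
proof -
  let ?U = "{u \<in> Pow {1..s}. d \<in> u}"
  have U: "finite u" "0 \<le> \<gamma> u" if "u \<in> ?U" for u
    using that \<gamma>[of u] finite_subset[of u "{1..s}"] by auto
  have nonneg: "0 \<le> step_error N d \<xi>" for \<xi>
    unfolding step_error_def using U by (intro sum_nonneg mult_nonneg_nonneg dual_sum_nonneg) auto
  \<comment> \<open>The power is taken before averaging, so that subadditivity can be applied to
    every single choice \<open>y\<close>.\<close>
  have "step_error N d (\<xi>(d := z)) powr \<theta> \<le>
      (\<Sum>y\<in>unit_residues N. step_error N d (\<xi>(d := y)) powr \<theta>) / real (card (unit_residues N))"
    using assms nonneg N by (intro minimum_le_mean powr_mono2) auto
  also have "\<dots> \<le>
      (\<Sum>y\<in>unit_residues N. \<Sum>u\<in>?U. \<gamma> u powr \<theta> * dual_sum (\<alpha> * \<theta>) N u (\<xi>(d := y))) / real (card (unit_residues N))"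
  proof (intro divide_right_mono sum_mono)
    fix y
    have "step_error N d (\<xi>(d := y)) powr \<theta> \<le> (\<Sum>u\<in>?U. (\<gamma> u * dual_sum \<alpha> N u (\<xi>(d := y))) powr \<theta>)"
      unfolding step_error_def using U assms
      by (intro powr_sum_le mult_nonneg_nonneg dual_sum_nonneg) auto
    also have "\<dots> \<le> (\<Sum>u\<in>?U. \<gamma> u powr \<theta> * dual_sum (\<alpha> * \<theta>) N u (\<xi>(d := y)))"
    proof (rule sum_mono)
      fix u assume u: "u \<in> ?U"
      have "(\<gamma> u * dual_sum \<alpha> N u (\<xi>(d := y))) powr \<theta> = \<gamma> u powr \<theta> * dual_sum \<alpha> N u (\<xi>(d := y)) powr \<theta>"
        using U[OF u] by (simp add: powr_mult dual_sum_nonneg)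
      also have "\<dots> \<le> \<gamma> u powr \<theta> * dual_sum (\<alpha> * \<theta>) N u (\<xi>(d := y))"
        using assms U[OF u] by (intro mult_left_mono dual_sum_powr_le) auto
      finally show "(\<gamma> u * dual_sum \<alpha> N u (\<xi>(d := y))) powr \<theta> \<le>
          \<gamma> u powr \<theta> * dual_sum (\<alpha> * \<theta>) N u (\<xi>(d := y))" .
    qed
    finally show "step_error N d (\<xi>(d := y)) powr \<theta> \<le>
        (\<Sum>u\<in>?U. \<gamma> u powr \<theta> * dual_sum (\<alpha> * \<theta>) N u (\<xi>(d := y)))" .
  qed simp
  also have "(\<Sum>y\<in>unit_residues N. \<Sum>u\<in>?U. \<gamma> u powr \<theta> * dual_sum (\<alpha> * \<theta>) N u (\<xi>(d := y))) =
      (\<Sum>u\<in>?U. \<gamma> u powr \<theta> * (\<Sum>y\<in>unit_residues N. dual_sum (\<alpha> * \<theta>) N u (\<xi>(d := y))))"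
    by (subst sum.swap) (simp add: sum_distrib_left)
  also have "\<dots> / real (card (unit_residues N)) \<le>
      (\<Sum>u\<in>?U. \<gamma> u powr \<theta> * (2 * zeta (\<alpha> * \<theta>)) ^ card u) / real (card (unit_residues N))"
    using assms U N by (intro divide_right_mono sum_mono mult_left_mono sum_dual_sum_le) auto
  finally show ?thesis .
qed

lemma scs_error_powr_le:
  assumes scs: "scs_output V ip N s z0 z" and \<theta>: "1 < \<alpha> * \<theta>" "0 < \<theta>" "\<theta> \<le> 1"
  shows "((worst_case_error V ip N s z)\<^sup>2) powr \<theta> \<le>
    (\<Sum>u\<in>Pow {1..s} - {{}}. real (card u) * (\<gamma> u powr \<theta> * (2 * zeta (\<alpha> * \<theta>)) ^ card u))
      / real (card (unit_residues N))"
proof -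
  \<comment> \<open>The vector at the start of step \<open>d\<close>; its entry at \<open>d\<close>
    is the one being replaced.\<close>
  define \<xi> where "\<xi> d = (\<lambda>j. if j < d then z j else z0 j)" for d
  have upd: "(\<lambda>j. if j < d then z j else if j = d then y else z0 j) = (\<xi> d)(d := y)" for d y
    by (auto simp: \<xi>_def)
  let ?U = "\<lambda>d. {u \<in> Pow {1..s}. d \<in> u}"
  let ?W = "\<lambda>d. {u \<in> Pow {1..s} - {{}}. Max u = d}"
  let ?c = "\<lambda>u. \<gamma> u powr \<theta> * (2 * zeta (\<alpha> * \<theta>)) ^ card u"
  let ?k = "real (card (unit_residues N))"
  have fin: "finite u" if "u \<subseteq> {1..s}" for u using that finite_subset by blast
  have Max_mem: "Max u \<in> {1..s}" if "u \<in> Pow {1..s} - {{}}" for u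
    using that Max_in[of u] fin by blast
  have step_nonneg: "0 \<le> step_error N d \<xi>" for d \<xi>
    unfolding step_error_def using \<gamma> by (intro sum_nonneg mult_nonneg_nonneg dual_sum_nonneg) auto
  have "(worst_case_error V ip N s z)\<^sup>2 = (\<Sum>d\<in>{1..s}. \<Sum>u\<in>?W d. \<gamma> u * dual_sum \<alpha> N u z)"
    unfolding worst_case_error_sq[OF N(1)]
    by (rule sum.group[symmetric]) (simp, simp, rule image_subsetI, rule Max_mem)
  also have "\<dots> \<le> (\<Sum>d\<in>{1..s}. step_error N d ((\<xi> d)(d := z d)))"
  proof (rule sum_mono)
    fix d assume "d \<in> {1..s}"
    have "(\<Sum>u\<in>?W d. \<gamma> u * dual_sum \<alpha> N u z) = (\<Sum>u\<in>?W d. \<gamma> u * dual_sum \<alpha> N u ((\<xi> d)(d := z d)))"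
    proof (intro sum.cong refl arg_cong2[of _ _ _ _ "(*)"] dual_sum_cong)
      fix u j assume "u \<in> ?W d" "j \<in> u"
      hence "j \<le> d" using fin by auto
      thus "z j = ((\<xi> d)(d := z d)) j" by (auto simp: \<xi>_def)
    qed
    also have "\<dots> \<le> step_error N d ((\<xi> d)(d := z d))"
      unfolding step_error_def
    \<comment> \<open>The sum is enlarged from sets with maximum \<open>d\<close> to all sets
      containing \<open>d\<close>, since only this larger sum is minimal for step
      \<open>d\<close>.\<close>
    proof (rule sum_mono2)
      show "?W d \<subseteq> ?U d" using fin Max_in by blast
    qed (auto intro!: mult_nonneg_nonneg \<gamma> dual_sum_nonneg)
    finally show "(\<Sum>u\<in>?W d. \<gamma> u * dual_sum \<alpha> N u z) \<le> step_error N d ((\<xi> d)(d := z d))" .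
  qed
  finally have "((worst_case_error V ip N s z)\<^sup>2) powr \<theta> \<le>
      (\<Sum>d\<in>{1..s}. step_error N d ((\<xi> d)(d := z d))) powr \<theta>"
    using \<theta> by (intro powr_mono2) auto
  also have "\<dots> \<le> (\<Sum>d\<in>{1..s}. step_error N d ((\<xi> d)(d := z d)) powr \<theta>)"
    using step_nonneg \<theta> by (intro powr_sum_le)
  also have "\<dots> \<le> (\<Sum>d\<in>{1..s}. (\<Sum>u\<in>?U d. ?c u) / ?k)"
  proof (intro sum_mono step_error_powr_le \<theta> step_error_minimal)
    fix d assume "d \<in> {1..s}"
    thus "is_arg_min (\<lambda>y. (worst_case_error V ip N s ((\<xi> d)(d := y)))\<^sup>2) (\<lambda>y. y \<in> unit_residues N) (z d)"
      using scs unfolding scs_output_def upd by blast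
  qed
  also have "\<dots> = (\<Sum>d\<in>{1..s}. \<Sum>u\<in>?U d. ?c u) / ?k"
    by (simp add: sum_divide_distrib)
  \<comment> \<open>Exchanging the sums counts every \<open>u\<close> once for each of its
    elements.\<close>
  also have "(\<Sum>d\<in>{1..s}. \<Sum>u\<in>?U d. ?c u) = (\<Sum>u\<in>Pow {1..s}. \<Sum>d\<in>{d \<in> {1..s}. d \<in> u}. ?c u)"
    by (rule sum.swap_restrict) auto
  also have "\<dots> = (\<Sum>u\<in>Pow {1..s}. real (card u) * ?c u)"
  proof (rule sum.cong[OF refl])
    fix u assume "u \<in> Pow {1..s}"
    hence "{d \<in> {1..s}. d \<in> u} = u" by auto
    thus "(\<Sum>d\<in>{d \<in> {1..s}. d \<in> u}. ?c u) = real (card u) * ?c u" by simp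
  qed
  also have "\<dots> = (\<Sum>u\<in>Pow {1..s} - {{}}. real (card u) * ?c u)"
    by (rule sum.mono_neutral_right) auto
  finally show ?thesis .
qed

end

end

section \<open>The error bound for prime powers and the resulting convergence rates\<close>

theorem theorem4:
  fixes b :: nat and \<alpha> :: real and \<gamma> :: "nat set \<Rightarrow> real"
    and V :: "nat \<Rightarrow> ((nat \<Rightarrow> real) \<Rightarrow> complex) set"
    and ip :: "nat \<Rightarrow> ((nat \<Rightarrow> real) \<Rightarrow> complex) \<Rightarrow> ((nat \<Rightarrow> real) \<Rightarrow> complex) \<Rightarrow> complex"
  assumes b: "prime b"
    and \<alpha>: "\<alpha> > 1"
    and \<gamma>_pos: "\<And>u. finite u \<Longrightarrow> u \<subseteq> {1..} \<Longrightarrow> \<gamma> u > 0"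
    and \<gamma>_empty: "\<gamma> {} = 1"
    and korobov_space: "\<And>s. s \<ge> 1 \<Longrightarrow>
      reproducing_kernel_hilbert_space (unit_cube s) (korobov_kernel \<alpha> \<gamma> s) (V s) (ip s)"
  shows
    "(\<forall>m\<ge>1. \<forall>s\<ge>1. \<forall>z0. (\<forall>j\<in>{1..s}. z0 j \<in> {0..int (b ^ m) - 1}) \<longrightarrow>
        (\<exists>z. scs_output (V s) (ip s) (b ^ m) s z0 z) \<and>
        (\<forall>z. scs_output (V s) (ip s) (b ^ m) s z0 z \<longrightarrow>
          (\<forall>\<theta>::real. 1 / \<alpha> < \<theta> \<and> \<theta> \<le> 1 \<longrightarrow>
            (worst_case_error (V s) (ip s) (b ^ m) s z)\<^sup>2 \<le>
              (\<Sum>u\<in>Pow {1..s} - {{}}. real (card u) * \<gamma> u powr \<theta> *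
                 (2 * (2 * zeta (\<alpha> * \<theta>)) ^ card u / real (b ^ m))) powr (1 / \<theta>))))
     \<and>
     (\<forall>\<delta>::real. 0 < \<delta> \<and> \<delta> \<le> (\<alpha> - 1) / 2 \<longrightarrow>
        (\<forall>s\<ge>1. \<forall>z0 z.
          (\<forall>m\<ge>1. (\<forall>j\<in>{1..s}. z0 m j \<in> {0..int (b ^ m) - 1}) \<and> scs_output (V s) (ip s) (b ^ m) s (z0 m) (z m)) \<longrightarrow>
          (\<lambda>m. worst_case_error (V s) (ip s) (b ^ m) s (z m)) \<in> O(\<lambda>m. real (b ^ m) powr (- \<alpha> / 2 + \<delta>)))
        \<and>
        ((SUP s\<in>{1..}. ereal (2 * (\<Sum>u\<in>Pow {1..s} - {{}}. real (card u) *
             \<gamma> u powr (1 / (\<alpha> - 2 * \<delta>)) * (2 * zeta (\<alpha> / (\<alpha> - 2 * \<delta>))) ^ card u))) < \<infinity> \<longrightarrow>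
         (\<exists>C. \<forall>s\<ge>1. \<forall>m\<ge>1. \<forall>z0 z.
            (\<forall>j\<in>{1..s}. z0 j \<in> {0..int (b ^ m) - 1}) \<and> scs_output (V s) (ip s) (b ^ m) s z0 z \<longrightarrow>
            worst_case_error (V s) (ip s) (b ^ m) s z \<le> C * real (b ^ m) powr (- \<alpha> / 2 + \<delta>))))"
proof -
  have N: "b ^ m > 0" for m using b prime_gt_0_nat by simp
  have units: "unit_residues (b ^ m) \<noteq> {}" if "m \<ge> 1" for m
    using card_unit_residues_ge[OF b that] N[of m]
    by (metis card.empty mult_zero_right not_le of_nat_0 of_nat_0_less_iff)
  have space: "korobov_space \<alpha> \<gamma> s (V s) (ip s)" if "s \<ge> 1" for s
    using korobov_space[OF that] \<alpha> by (simp add: korobov_space_def korobov_space_axioms_def)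
  have \<gamma>: "0 \<le> \<gamma> u" if "u \<subseteq> {1..s}" "u \<noteq> {}" for u s
    using \<gamma>_pos[of u] that finite_subset[OF that(1)] by force
  \<comment> \<open>Chosen so that the bound reads
    \<open>(A s \<theta> / N) powr (1 / \<theta>)\<close>; at
    \<open>\<theta> = 1 / (\<alpha> - 2 * \<delta>)\<close> it is the quantity whose supremum over
    \<open>s\<close> is assumed finite.\<close>
  define A where "A s \<theta> =
      2 * (\<Sum>u\<in>Pow {1..s} - {{}}. real (card u) * \<gamma> u powr \<theta> * (2 * zeta (\<alpha> * \<theta>)) ^ card u)"
    for s \<theta>
  have A_nonneg: "0 \<le> A s \<theta>" if "1 < \<alpha> * \<theta>" for s \<theta>
    unfolding A_def using zeta_nonneg[OF that] by (intro mult_nonneg_nonneg sum_nonneg) auto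
  have bound: "(worst_case_error (V s) (ip s) (b ^ m) s z)\<^sup>2 \<le> (A s \<theta> / real (b ^ m)) powr (1 / \<theta>)"
    if "m \<ge> 1" "s \<ge> 1" "scs_output (V s) (ip s) (b ^ m) s z0 z" "1 / \<alpha> < \<theta>" "\<theta> \<le> 1" for m s z0 z \<theta>
  proof -
    interpret korobov_space \<alpha> \<gamma> s "V s" "ip s" using space that by blast
    have "0 < 1 / \<alpha>" using \<alpha> by simp
    hence \<theta>: "0 < \<theta>" using that by linarith
    have \<alpha>\<theta>: "1 < \<alpha> * \<theta>" using that \<alpha> by (simp add: pos_divide_less_eq mult.commute)
    let ?S = "\<Sum>u\<in>Pow {1..s} - {{}}. real (card u) * (\<gamma> u powr \<theta> * (2 * zeta (\<alpha> * \<theta>)) ^ card u)"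
    have S: "A s \<theta> = 2 * ?S" unfolding A_def by (simp add: mult.assoc)
    have "((worst_case_error (V s) (ip s) (b ^ m) s z)\<^sup>2) powr \<theta> \<le>
        ?S / real (card (unit_residues (b ^ m)))"
      by (rule scs_error_powr_le[OF N units[OF that(1)] \<gamma> that(3) \<alpha>\<theta> \<theta> that(5)])
    also have "\<dots> \<le> ?S / (real (b ^ m) / 2)"
      using card_unit_residues_ge[OF b that(1)] A_nonneg[OF \<alpha>\<theta>, of s] N[of m]
      by (intro divide_left_mono mult_pos_pos) (auto simp: S card_gt_0_iff units[OF that(1)])
    also have "\<dots> = A s \<theta> / real (b ^ m)" by (simp add: S)
    finally show ?thesis
      using \<theta> A_nonneg[OF \<alpha>\<theta>, of s] by (subst le_powr_inverse_iff) auto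
  qed
  \<comment> \<open>The choice \<open>\<theta> = 1 / (\<alpha> - 2 * \<delta>)\<close> is
    admissible: \<open>0 < \<delta>\<close> gives \<open>1 / \<alpha> < \<theta>\<close>, and
    \<open>\<delta> \<le> (\<alpha> - 1) / 2\<close> gives \<open>\<theta> \<le> 1\<close>. The
    square root then halves the exponent \<open>\<alpha> - 2 * \<delta>\<close>.\<close>
  have rate: "worst_case_error (V s) (ip s) (b ^ m) s z \<le>
      A s (1 / (\<alpha> - 2 * \<delta>)) powr ((\<alpha> - 2 * \<delta>) / 2) * real (b ^ m) powr (- \<alpha> / 2 + \<delta>)"
    if "0 < \<delta>" "\<delta> \<le> (\<alpha> - 1) / 2" "m \<ge> 1" "s \<ge> 1" "scs_output (V s) (ip s) (b ^ m) s z0 z" for \<delta> m s z0 z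
  proof -
    let ?t = "\<alpha> - 2 * \<delta>"
    have t: "1 \<le> ?t" "?t < \<alpha>" using that by auto
    have \<theta>: "1 / \<alpha> < 1 / ?t" "1 / ?t \<le> 1" using t by (auto intro!: divide_strict_left_mono)
    have "1 < \<alpha> * (1 / ?t)" using t by simp
    note A = A_nonneg[OF this, of s]
    have "(worst_case_error (V s) (ip s) (b ^ m) s z)\<^sup>2 \<le> (A s (1 / ?t) / real (b ^ m)) powr ?t"
      using bound[OF that(3-5) \<theta>] by simp
    hence "worst_case_error (V s) (ip s) (b ^ m) s z \<le> sqrt ((A s (1 / ?t) / real (b ^ m)) powr ?t)"
      by (rule real_le_rsqrt)
    also have "\<dots> = (A s (1 / ?t) / real (b ^ m)) powr (?t / 2)"
      by (simp add: powr_half_sqrt[symmetric] powr_powr)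
    also have "\<dots> = A s (1 / ?t) powr (?t / 2) * real (b ^ m) powr (- (?t / 2))"
      using A by (simp add: powr_divide powr_minus_divide del: of_nat_power)
    also have "- (?t / 2) = - \<alpha> / 2 + \<delta>" by (simp add: field_simps)
    finally show ?thesis .
  qed
  show ?thesis
  proof (intro conjI allI impI, goal_cases)
    case (1 m s z0)
    show ?case using scs_output_exists units[OF 1(1)] by blast
  next
    case (2 m s z0 z \<theta>)
    have "A s \<theta> / real (b ^ m) = (\<Sum>u\<in>Pow {1..s} - {{}}. real (card u) * \<gamma> u powr \<theta> *
                 (2 * (2 * zeta (\<alpha> * \<theta>)) ^ card u / real (b ^ m)))"
      unfolding A_def by (simp add: sum_distrib_left sum_divide_distrib mult_ac)
    thus ?case using bound[of m s z0 z \<theta>] 2 by simp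
  next
    case (3 \<delta> s z0 z)
    show ?case
    proof (rule landau_o.bigI)
      let ?C = "A s (1 / (\<alpha> - 2 * \<delta>)) powr ((\<alpha> - 2 * \<delta>) / 2)"
      \<comment> \<open>Adding 1 gives a strictly positive constant without having to show that
        \<open>A\<close> is nonzero.\<close>
      show "0 < ?C + 1" by (simp add: add_nonneg_pos)
      show "\<forall>\<^sub>F m in sequentially. norm (worst_case_error (V s) (ip s) (b ^ m) s (z m)) \<le>
          (?C + 1) * norm (real (b ^ m) powr (- \<alpha> / 2 + \<delta>))"
      proof (rule eventually_sequentiallyI)
        fix m :: nat assume m: "1 \<le> m"
        interpret korobov_space \<alpha> \<gamma> s "V s" "ip s" using space 3 by blast
        have "0 \<le> worst_case_error (V s) (ip s) (b ^ m) s (z m)"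
          using worst_case_error_nonneg[OF N] .
        moreover have "worst_case_error (V s) (ip s) (b ^ m) s (z m) \<le> ?C * real (b ^ m) powr (- \<alpha> / 2 + \<delta>)"
          using rate[of \<delta> m s "z0 m" "z m"] 3 m by blast
        moreover have "?C * real (b ^ m) powr (- \<alpha> / 2 + \<delta>) \<le> (?C + 1) * real (b ^ m) powr (- \<alpha> / 2 + \<delta>)"
          by (intro mult_right_mono) auto
        ultimately show "norm (worst_case_error (V s) (ip s) (b ^ m) s (z m)) \<le>
            (?C + 1) * norm (real (b ^ m) powr (- \<alpha> / 2 + \<delta>))" by simp
      qed
    qed
  next
    case (4 \<delta>)
    let ?\<theta> = "1 / (\<alpha> - 2 * \<delta>)"
    have t: "1 \<le> \<alpha> - 2 * \<delta>" "\<alpha> - 2 * \<delta> < \<alpha>" using 4 by auto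
    have A_eq: "A s ?\<theta> = 2 * (\<Sum>u\<in>Pow {1..s} - {{}}. real (card u) *
             \<gamma> u powr (1 / (\<alpha> - 2 * \<delta>)) * (2 * zeta (\<alpha> / (\<alpha> - 2 * \<delta>))) ^ card u)" for s
      unfolding A_def by simp
    have "(SUP s\<in>{1..}. ereal (A s ?\<theta>)) < \<infinity>" using 4(2) unfolding A_eq .
    \<comment> \<open>The supremum is an extended real below infinity, hence below some real
      \<open>B\<close>, which then serves for all \<open>s\<close> at once.\<close>
    then obtain B where B: "(SUP s\<in>{1..}. ereal (A s ?\<theta>)) < ereal B"
      using less_PInf_Ex_of_nat by fastforce
    have A_le: "A s ?\<theta> \<le> B" if "s \<ge> 1" for s
    proof -
      have "ereal (A s ?\<theta>) \<le> (SUP s\<in>{1..}. ereal (A s ?\<theta>))" using that by (intro SUP_upper) auto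
      hence "ereal (A s ?\<theta>) < ereal B" using B by (rule order.strict_trans1)
      thus ?thesis by simp
    qed
    have "worst_case_error (V s) (ip s) (b ^ m) s z \<le>
        B powr ((\<alpha> - 2 * \<delta>) / 2) * real (b ^ m) powr (- \<alpha> / 2 + \<delta>)"
      if "s \<ge> 1" "m \<ge> 1" "scs_output (V s) (ip s) (b ^ m) s z0 z" for s m z0 z
    proof -
      have "1 < \<alpha> * ?\<theta>" using t by simp
      hence "A s ?\<theta> powr ((\<alpha> - 2 * \<delta>) / 2) \<le> B powr ((\<alpha> - 2 * \<delta>) / 2)"
        using t A_le[OF that(1)] A_nonneg by (intro powr_mono2) auto
      hence "A s ?\<theta> powr ((\<alpha> - 2 * \<delta>) / 2) * real (b ^ m) powr (- \<alpha> / 2 + \<delta>) \<le>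
          B powr ((\<alpha> - 2 * \<delta>) / 2) * real (b ^ m) powr (- \<alpha> / 2 + \<delta>)"
        by (intro mult_right_mono) auto
      thus ?thesis using rate[of \<delta> m s z0 z] 4 that by linarith
    qed
    thus ?case by blast
  qed
qed

end
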